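(* Let $\mathbb{K}$ be an algebraically closed field of characteristic zero, $f_1,\ldots,f_m\in\mathbb{K}[x_1,\ldots,x_m]$ generating an ideal $I$ with $\mathbb{K}[\mathbf{x}]/I$ finite dimensional (finitely many affine common roots), and let $J=\det(\partial f_i/\partial x_j)_{i,j=1}^m$ be the Jacobian. With the notation below, set $$\ker(\mathfrak{B}_J^{\mathbf{x}}):=\Big\{\lambda=(\lambda_\beta)_{\beta\in E'}\in\mathbb{K}^{E'}:\ \sum_{\alpha\in E,\beta\in E'}c_{\alpha,\beta}(J)\,\mathbf{x}^\alpha\lambda_\beta=0\Big\}.$$ Then $$\sqrt{I}=\Big\{\sum_{\alpha\in E,\beta\in E'}c_{\alpha,\beta}(1)\,\mathbf{x}^\alpha\lambda_\beta:\ \lambda\in\ker(\mathfrak{B}_J^{\mathbf{x}})\Big\}+I.$$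
   Context: Let $\mathbf{x}=(x_1,\ldots,x_m)$, $\mathbf{y}=(y_1,\ldots,y_m)$ and $X_0=(x_1,\ldots,x_m)$, $X_1=(y_1,x_2,\ldots,x_m)$, …, $X_m=(y_1,\ldots,y_m)$ (in $X_i$ the first $i$ coordinates are $y$'s). For $f_0\in\mathbb{K}[\mathbf{x}]$, the Bezoutian of $(f_0,f_1,\ldots,f_m)$ is the polynomial $\mathfrak{B}_{f_0}(\mathbf{x},\mathbf{y})\in\mathbb{K}[\mathbf{x},\mathbf{y}]$ given by the $(m+1)\times(m+1)$ determinant whose row $i$ ($i=0,\ldots,m$) is $\big(f_i(X_0),\ \frac{f_i(X_0)-f_i(X_1)}{x_1-y_1},\ \ldots,\ \frac{f_i(X_{m-1})-f_i(X_m)}{x_m-y_m}\big)$. Write $\mathfrak{B}_{f_0}(\mathbf{x},\mathbf{y})=\sum_{\alpha\in E,\beta\in E'}c_{\alpha,\beta}(f_0)\mathbf{x}^\alpha\mathbf{y}^\beta$ with $c_{\alpha,\beta}(f_0)\in\mathbb{K}$, where $E,E'\subset\mathbb{N}^m$ are finite sets of exponents containing the supports of all Bezoutians considered (here $f_0=1$ and $f_0=J$), coefficients outside the support being $0$. *)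

theory Defs
  imports "HOL-Library.Poly_Mapping" "HOL-Computational_Algebra.Polynomial"
    "HOL-Combinatorics.Permutations"
begin

text \<open>Multivariate polynomials over 'a: finitely supported maps from monomials
  (exponent vectors, variable k having index k) to coefficients.
  K[x_1..x_m] is represented by variables 0..m-1 (x_j is variable j-1);
  in K[x,y] the variable y_j is variable m+j-1.\<close>

type_synonym 'a mpoly = "(nat \<Rightarrow>\<^sub>0 nat) \<Rightarrow>\<^sub>0 'a"

definition mconst :: "'a::comm_ring_1 \<Rightarrow> 'a mpoly" where
  "mconst c = Poly_Mapping.single 0 c"

definition mvar :: "nat \<Rightarrow> 'a::comm_ring_1 mpoly" where
  "mvar k = Poly_Mapping.single (Poly_Mapping.single k 1) 1"

definition mmonom :: "(nat \<Rightarrow>\<^sub>0 nat) \<Rightarrow> 'a::comm_ring_1 mpoly" where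
  "mmonom \<alpha> = Poly_Mapping.single \<alpha> 1"

definition polys_in :: "nat \<Rightarrow> 'a::comm_ring_1 mpoly set" where
  "polys_in n = {p. \<forall>\<alpha>\<in>Poly_Mapping.keys p. Poly_Mapping.keys \<alpha> \<subseteq> {..<n}}"

definition msubst :: "(nat \<Rightarrow> 'a::comm_ring_1 mpoly) \<Rightarrow> 'a mpoly \<Rightarrow> 'a mpoly" where
  "msubst \<sigma> p = (\<Sum>\<alpha>\<in>Poly_Mapping.keys p. mconst (Poly_Mapping.lookup p \<alpha>) * (\<Prod>k\<in>Poly_Mapping.keys \<alpha>. (\<sigma> k) ^ Poly_Mapping.lookup \<alpha> k))"

definition mpderiv :: "nat \<Rightarrow> 'a::comm_ring_1 mpoly \<Rightarrow> 'a mpoly" where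
  "mpderiv k p = (\<Sum>\<alpha>\<in>Poly_Mapping.keys p.
      Poly_Mapping.single (\<alpha> - Poly_Mapping.single k 1) (of_nat (Poly_Mapping.lookup \<alpha> k) * Poly_Mapping.lookup p \<alpha>))"

definition det_on :: "nat set \<Rightarrow> (nat \<Rightarrow> nat \<Rightarrow> 'a::comm_ring_1) \<Rightarrow> 'a" where
  "det_on S A = (\<Sum>p | p permutes S. of_int (sign p) * (\<Prod>i\<in>S. A i (p i)))"

definition gen_ideal :: "nat \<Rightarrow> (nat \<Rightarrow> 'a::comm_ring_1 mpoly) \<Rightarrow> 'a mpoly set" where
  "gen_ideal m fs = {(\<Sum>i=1..m. g i * fs i) | g. \<forall>i\<in>{1..m}. g i \<in> polys_in m}"

definition radical_in :: "nat \<Rightarrow> 'a::comm_ring_1 mpoly set \<Rightarrow> 'a mpoly set" where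
  "radical_in m I = {p \<in> polys_in m. \<exists>k. p ^ k \<in> I}"

definition fin_dim_quotient :: "nat \<Rightarrow> 'a::comm_ring_1 mpoly set \<Rightarrow> bool" where
  "fin_dim_quotient m I \<longleftrightarrow> (\<exists>B. finite B \<and> B \<subseteq> polys_in m \<and>
     (\<forall>p\<in>polys_in m. \<exists>c. p - (\<Sum>b\<in>B. mconst (c b) * b) \<in> I))"

definition jacobian :: "nat \<Rightarrow> (nat \<Rightarrow> 'a::comm_ring_1 mpoly) \<Rightarrow> 'a mpoly" where
  "jacobian m fs = det_on {1..m} (\<lambda>i j. mpderiv (j - 1) (fs i))"

text \<open>the point X_i = (y_1,..,y_i,x_{i+1},..,x_m)\<close>
definition Xsubst :: "nat \<Rightarrow> nat \<Rightarrow> nat \<Rightarrow> 'a::comm_ring_1 mpoly" where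
  "Xsubst m i l = (if l < i then mvar (m + l) else mvar l)"

text \<open>(f(X_{j-1}) - f(X_j)) / (x_j - y_j), j = 1..m (exact quotient)\<close>
definition divdiff :: "nat \<Rightarrow> nat \<Rightarrow> 'a::comm_ring_1 mpoly \<Rightarrow> 'a mpoly" where
  "divdiff m j f = (THE q. q * (mvar (j - 1) - mvar (m + j - 1)) =
      msubst (Xsubst m (j - 1)) f - msubst (Xsubst m j) f)"

definition bezoutian :: "nat \<Rightarrow> (nat \<Rightarrow> 'a::comm_ring_1 mpoly) \<Rightarrow> 'a mpoly \<Rightarrow> 'a mpoly" where
  "bezoutian m fs f0 = det_on {0..m} (\<lambda>i j.
      let fi = (if i = 0 then f0 else fs i) in
      if j = 0 then fi else divdiff m j fi)"

definition yshift :: "nat \<Rightarrow> (nat \<Rightarrow>\<^sub>0 nat) \<Rightarrow> (nat \<Rightarrow>\<^sub>0 nat)" where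
  "yshift m \<beta> = (\<Sum>k\<in>Poly_Mapping.keys \<beta>. Poly_Mapping.single (m + k) (Poly_Mapping.lookup \<beta> k))"

definition bez_coeff :: "nat \<Rightarrow> (nat \<Rightarrow> 'a::comm_ring_1 mpoly) \<Rightarrow> 'a mpoly \<Rightarrow>
    (nat \<Rightarrow>\<^sub>0 nat) \<Rightarrow> (nat \<Rightarrow>\<^sub>0 nat) \<Rightarrow> 'a" where
  "bez_coeff m fs f0 \<alpha> \<beta> = Poly_Mapping.lookup (bezoutian m fs f0) (\<alpha> + yshift m \<beta>)"

end

theory Submission
  imports Defs "Jordan_Normal_Form.Schur_Decomposition" "Jordan_Normal_Form.DL_Rank"
begin

text \<open>
  Let \<open>I\<close> be the ideal of the \<open>f\<^sub>i\<close>, \<open>\<B>\<^sub>h\<close> the Bezoutian of \<open>h\<close>, and \<open>\<Delta>\<close> the determinant of the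
  divided differences of the \<open>f\<^sub>i\<close>, which is \<open>\<B>\<^sub>1\<close>. By Cramer's rule, \<open>\<B>\<^sub>h \<equiv> h(x) \<Delta>\<close> modulo \<open>I(x)\<close> and
  \<open>\<B>\<^sub>h \<equiv> h(y) \<Delta>\<close> modulo \<open>I(y)\<close>.

  Some linear functional \<open>\<tau>\<close> vanishing on \<open>I\<close>, the residue, satisfies \<open>\<tau>\<^sub>y \<Delta> \<equiv> 1\<close> modulo \<open>I\<close>. For
  univariate \<open>f\<^sub>i(x\<^sub>i)\<close> it is a product of univariate residues. In general \<open>I\<close> contains a univariate
  system \<open>g = M f\<close>, the two Bezoutians are related by \<open>det M(y) \<Delta>\<^sub>f \<equiv> \<Delta>\<^sub>g\<close> modulo \<open>f(x)\<close> and \<open>g(y)\<close>, and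
  \<open>\<tau>\<^sub>f\<close> is \<open>\<tau>\<^sub>g\<close> composed with multiplication by \<open>det M\<close>. The relation holds because two matrices
  expressing the same elements by the regular sequence \<open>x\<^sub>j - y\<^sub>j\<close> have determinants that agree
  modulo these elements.

  The congruences for \<open>\<B>\<^sub>h\<close> now give \<open>\<tau>\<^sub>y (h(y) \<Delta>) \<equiv> h(x)\<close> for all \<open>h\<close>, and that the ideal quotient
  \<open>I : h\<close> is the sum of \<open>I\<close> and the image of the kernel of \<open>\<B>\<^sub>h\<close> under \<open>\<Delta>\<close>.

  Finally \<open>I : J\<close> is the radical. Writing \<open>\<Delta> = \<Sum> a\<^sub>i(x) b\<^sub>i(y)\<close>, the matrices \<open>T\<^sub>h = (\<tau>(h a\<^sub>i b\<^sub>j))\<close>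
  multiply like the classes of the polynomials \<open>h\<close> modulo \<open>I\<close>, and \<open>T\<^sub>h\<close> has trace \<open>\<tau>(h J)\<close> since
  \<open>J(x) = \<Delta>(x,x)\<close>. In characteristic zero, a matrix is nilpotent iff all its powers have trace zero.
\<close>

subsection \<open>Traces and nilpotent matrices\<close>

lemma exists_invertible_mat_with_col_0:
  fixes v :: "'a::field vec"
  assumes v: "v \<in> carrier_vec (Suc n)" and v_nz: "v \<noteq> 0\<^sub>v (Suc n)"
  obtains P Q where "P \<in> carrier_mat (Suc n) (Suc n)" "Q \<in> carrier_mat (Suc n) (Suc n)"
    "P * Q = 1\<^sub>m (Suc n)" "Q * P = 1\<^sub>m (Suc n)" "col P 0 = v"
proof -
  interpret vec_space "TYPE('a)" "Suc n" .
  define vs where "vs = basis_completion v"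
  define P where "P = mat_of_cols (Suc n) vs"
  note vs = basis_completion[OF v v_nz, folded vs_def]
  have P: "P \<in> carrier_mat (Suc n) (Suc n)"
    unfolding P_def using vs(6) by (metis mat_of_cols_carrier(1))
  have cols: "cols P = vs"
    unfolding P_def using vs(2) by (intro cols_mat_of_cols) auto
  have "rank P = Suc n"
    by (rule lin_indpt_full_rank[OF P]) (use cols vs in auto)
  then have "det P \<noteq> 0"
    using det_rank_iff[OF P] by simp
  then obtain Q where "Q \<in> carrier_mat (Suc n) (Suc n)" "P * Q = 1\<^sub>m (Suc n)" "Q * P = 1\<^sub>m (Suc n)"
    using det_non_zero_imp_unit[OF P, of "()"] unfolding Units_def ring_mat_def by auto
  moreover have "col P 0 = v"
    using cols P vs(6,7)
    by (metis carrier_matD(2) cols_nth hd_conv_nth list.size(3) nat.distinct(1) zero_less_Suc)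
  ultimately show ?thesis
    using that P by blast
qed

lemma eq_four_block_mat_if_col_0:
  fixes A :: "'a::zero mat"
  assumes A: "A \<in> carrier_mat (Suc n) (Suc n)"
    and col: "\<And>i. i < Suc n \<Longrightarrow> A $$ (i, 0) = (if i = 0 then e else 0)"
  obtains B C where "B \<in> carrier_mat 1 n" "C \<in> carrier_mat n n"
    "A = four_block_mat (mat 1 1 (\<lambda>_. e)) B (0\<^sub>m n 1) C"
proof -
  define B where "B = mat 1 n (\<lambda>(i, j). A $$ (0, Suc j))"
  define C where "C = mat n n (\<lambda>(i, j). A $$ (Suc i, Suc j))"
  let ?M = "four_block_mat (mat 1 1 (\<lambda>_. e)) B (0\<^sub>m n 1) C"
  have A_eq: "A = ?M"
  proof (rule eq_matI)
    fix i j assume "i < dim_row ?M" "j < dim_col ?M"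
    then have "i < Suc n" "j < Suc n"
      by (simp_all add: C_def)
    then show "A $$ (i, j) = ?M $$ (i, j)"
      by (cases i; cases j) (simp_all add: col B_def C_def)
  qed (use A in \<open>simp_all add: C_def\<close>)
  show ?thesis
    by (rule that[OF _ _ A_eq]) (simp_all add: B_def C_def)
qed

lemma similar_mat_four_block_of_eigenvalue:
  fixes A :: "'a::field mat"
  assumes A: "A \<in> carrier_mat (Suc n) (Suc n)" and "eigenvalue A e"
  obtains B C where "B \<in> carrier_mat 1 n" "C \<in> carrier_mat n n"
    "similar_mat A (four_block_mat (mat 1 1 (\<lambda>_. e)) B (0\<^sub>m n 1) C)"
proof -
  let ?N = "Suc n"
  obtain v where v: "v \<in> carrier_vec ?N" and v_nz: "v \<noteq> 0\<^sub>v ?N" and Av: "A *\<^sub>v v = e \<cdot>\<^sub>v v"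
    using assms unfolding eigenvalue_def eigenvector_def by auto
  obtain P Q where P: "P \<in> carrier_mat ?N ?N" and Q: "Q \<in> carrier_mat ?N ?N"
    and PQ: "P * Q = 1\<^sub>m ?N" and QP: "Q * P = 1\<^sub>m ?N" and P_col: "col P 0 = v"
    using exists_invertible_mat_with_col_0[OF v v_nz] by blast
  define A' where "A' = Q * A * P"
  have A': "A' \<in> carrier_mat ?N ?N"
    unfolding A'_def using P Q A by simp
  have sim: "similar_mat A' A"
    by (rule similar_matI[OF _ QP PQ A'_def]) (use P Q A A' in auto)
  have Qv: "Q *\<^sub>v v = unit_vec ?N 0"
    using col_mult2[OF Q P, of 0] QP P_col by simp
  have "col A' 0 = (Q * A) *\<^sub>v v"
    unfolding A'_def using col_mult2[of "Q * A" ?N ?N P ?N 0] P Q A P_col by simp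
  also have "\<dots> = Q *\<^sub>v (e \<cdot>\<^sub>v v)"
    using Av Q A v by (metis assoc_mult_mat_vec)
  finally have A'_col: "col A' 0 = e \<cdot>\<^sub>v unit_vec ?N 0"
    using Qv Q v by (simp add: mult_mat_vec)
  have "A' $$ (i, 0) = (if i = 0 then e else 0)" if "i < ?N" for i
    using arg_cong[OF A'_col, of "\<lambda>u. u $ i"] that A' by simp
  then obtain B C where "B \<in> carrier_mat 1 n" "C \<in> carrier_mat n n"
    "A' = four_block_mat (mat 1 1 (\<lambda>_. e)) B (0\<^sub>m n 1) C"
    using eq_four_block_mat_if_col_0[OF A'] by blast
  then show ?thesis
    using that similar_mat_sym[OF sim] by blast
qed

lemma triangularizable:
  fixes A :: "'a::alg_closed_field mat"
  assumes "A \<in> carrier_mat n n"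
  shows "\<exists>T\<in>carrier_mat n n. upper_triangular T \<and> similar_mat A T"
  using assms
proof (induction n arbitrary: A)
  case 0
  then show ?case
    by (intro bexI[of _ A] conjI similar_mat_refl upper_triangularI) auto
next
  case (Suc n)
  note A = Suc.prems
  have "degree (char_poly A) = Suc n"
    using degree_monic_char_poly[OF A] by simp
  then obtain e where "poly (char_poly A) e = 0"
    using alg_closed_imp_poly_has_root[of "char_poly A"] by auto
  then have "eigenvalue A e"
    using eigenvalue_root_char_poly[OF A] by simp
  let ?e = "mat 1 1 (\<lambda>_. e)"
  have e_carrier: "?e \<in> carrier_mat 1 1"
    by simp
  obtain B C where B: "B \<in> carrier_mat 1 n" and C: "C \<in> carrier_mat n n"
    and A_sim: "similar_mat A (four_block_mat ?e B (0\<^sub>m n 1) C)"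
    using similar_mat_four_block_of_eigenvalue[OF A \<open>eigenvalue A e\<close>] by blast
  obtain T where T: "T \<in> carrier_mat n n" "upper_triangular T" "similar_mat C T"
    using Suc.IH[OF C] by blast
  obtain B' where B': "B' \<in> carrier_mat 1 n"
    and block_sim: "similar_mat (four_block_mat ?e B (0\<^sub>m n 1) C) (four_block_mat ?e B' (0\<^sub>m n 1) T)"
    using similar_mat_four_block_0_ex[OF similar_mat_refl[OF e_carrier] T(3) B e_carrier C] by blast
  have "similar_mat A (four_block_mat ?e B' (0\<^sub>m n 1) T)"
    using similar_mat_trans[OF A_sim block_sim] .
  moreover have "upper_triangular (four_block_mat ?e B' (0\<^sub>m n 1) T)"
    by (rule upper_triangular_four_block[OF e_carrier T(1) _ T(2)]) auto
  moreover have "four_block_mat ?e B' (0\<^sub>m n 1) T \<in> carrier_mat (Suc n) (Suc n)"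
    using four_block_carrier_mat[OF e_carrier T(1)] by simp
  ultimately show ?case
    by blast
qed

definition mat_trace :: "'a::comm_ring_1 mat \<Rightarrow> 'a" where
  "mat_trace A = (\<Sum>i<dim_row A. A $$ (i, i))"

lemma mat_trace_mult_commute:
  assumes "A \<in> carrier_mat n k" "B \<in> carrier_mat k n"
  shows "mat_trace (A * B) = mat_trace (B * A)"
proof -
  have "mat_trace (A * B) = (\<Sum>i<n. \<Sum>j<k. A $$ (i, j) * B $$ (j, i))"
    using assms by (simp add: mat_trace_def scalar_prod_def atLeast0LessThan)
  also have "\<dots> = (\<Sum>j<k. \<Sum>i<n. B $$ (j, i) * A $$ (i, j))"
    by (subst sum.swap) (simp add: mult.commute)
  also have "\<dots> = mat_trace (B * A)"
    using assms by (simp add: mat_trace_def scalar_prod_def atLeast0LessThan)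
  finally show ?thesis .
qed

lemma mat_trace_similar:
  assumes "similar_mat A B"
  shows "mat_trace A = mat_trace B"
proof -
  obtain n P Q where carrier: "{A, B, P, Q} \<subseteq> carrier_mat n n"
    and QP: "Q * P = 1\<^sub>m n" and A: "A = P * B * Q"
    using similar_matD[OF assms] by blast
  have "mat_trace A = mat_trace (Q * (P * B))"
    unfolding A by (rule mat_trace_mult_commute) (use carrier in auto)
  also have "Q * (P * B) = (Q * P) * B"
    using carrier by (simp add: assoc_mult_mat[of Q n n P n B n])
  finally show ?thesis
    using QP carrier left_mult_one_mat[of B n n] by simp
qed

lemma similar_mat_pow:
  assumes "similar_mat A B"
  shows "similar_mat (A ^\<^sub>m k) (B ^\<^sub>m k)"
  using assms similar_mat_wit_pow unfolding similar_mat_def by blast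

lemma similar_mat_pow_eq_0:
  fixes A :: "'a::comm_ring_1 mat"
  assumes "similar_mat A B" and A: "A \<in> carrier_mat n n" and "B ^\<^sub>m k = 0\<^sub>m n n"
  shows "A ^\<^sub>m k = 0\<^sub>m n n"
proof -
  obtain P Q where wit: "similar_mat_wit A B P Q"
    using assms(1) unfolding similar_mat_def by blast
  have "P \<in> carrier_mat n n" "Q \<in> carrier_mat n n"
    using similar_mat_witD2[OF A wit] by auto
  then show ?thesis
    using similar_mat_wit_pow_id[OF wit, of k] assms(3) by simp
qed

lemma index_pow_mat_Suc:
  assumes "A \<in> carrier_mat n n" "i < n" "j < n"
  shows "(A ^\<^sub>m Suc k) $$ (i, j) = (\<Sum>l<n. (A ^\<^sub>m k) $$ (i, l) * A $$ (l, j))"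
proof -
  have "A ^\<^sub>m k \<in> carrier_mat n n"
    using assms by simp
  then show ?thesis
    using assms by (simp add: scalar_prod_def atLeast0LessThan)
qed

lemma index_pow_upper_triangular:
  assumes A: "A \<in> carrier_mat n n" and tri: "upper_triangular A" and "i < n" "j \<le> i"
  shows "(A ^\<^sub>m k) $$ (i, j) = (if j = i then A $$ (i, i) ^ k else 0)"
  using assms(3,4)
proof (induction k arbitrary: i j)
  case 0
  then show ?case
    using A by auto
next
  case (Suc k)
  have "(A ^\<^sub>m k) $$ (i, l) * A $$ (l, j) = (if l = i then A $$ (i, i) ^ k * A $$ (i, j) else 0)"
    if "l < n" for l
  proof (cases "l \<le> i")
    case True
    then show ?thesis
      using Suc.IH[of i l] Suc.prems by auto
  next
    case False
    then show ?thesis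
      using upper_triangularD[OF tri, of j l] A Suc.prems that by auto
  qed
  then have "(A ^\<^sub>m Suc k) $$ (i, j) = A $$ (i, i) ^ k * A $$ (i, j)"
    using index_pow_mat_Suc[OF A, of i j k] Suc.prems by simp
  then show ?case
    using upper_triangularD[OF tri, of j i] A Suc.prems
    by (cases "j = i") (auto simp: power_commutes)
qed

lemma index_pow_strictly_upper_triangular:
  assumes A: "A \<in> carrier_mat n n" and tri: "upper_triangular A"
    and diag: "\<And>i. i < n \<Longrightarrow> A $$ (i, i) = 0"
    and "i < n" "j < n" "j < i + k"
  shows "(A ^\<^sub>m k) $$ (i, j) = 0"
  using assms(4-)
proof (induction k arbitrary: i j)
  case 0
  then show ?case
    using A by auto
next
  case (Suc k)
  have "(A ^\<^sub>m k) $$ (i, l) * A $$ (l, j) = 0" if "l < n" for l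
  proof (cases "l < i + k")
    case True
    then show ?thesis
      using Suc.IH[of i l] Suc.prems that by simp
  next
    case False
    then have "j \<le> l"
      using Suc.prems by simp
    then show ?thesis
      using upper_triangularD[OF tri, of j l] diag[OF that] A that by (cases "j = l") auto
  qed
  then show ?case
    using index_pow_mat_Suc[OF A, of i j k] Suc.prems by simp
qed

lemma mat_trace_pow_similar_triangular:
  assumes "similar_mat A T" "T \<in> carrier_mat n n" "upper_triangular T"
  shows "mat_trace (A ^\<^sub>m k) = (\<Sum>i<n. (T $$ (i, i)) ^ k)"
proof -
  have "mat_trace (A ^\<^sub>m k) = mat_trace (T ^\<^sub>m k)"
    by (rule mat_trace_similar[OF similar_mat_pow[OF assms(1)]])
  then show ?thesis
    using index_pow_upper_triangular[OF assms(2,3) _ order_refl] assms(2)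
    by (simp add: mat_trace_def)
qed

lemma eq_0_if_power_sums_eq_0:
  fixes x :: "nat \<Rightarrow> 'a::field_char_0"
  assumes power_sums: "\<And>k. k > 0 \<Longrightarrow> (\<Sum>i<n. x i ^ k) = 0" and "i < n"
  shows "x i = 0"
proof (rule ccontr)
  assume xi: "x i \<noteq> 0"
  define q where "q = (\<Prod>c\<in>x ` {..<n} - {x i}. [:- c, 1:])"
  have q_other: "poly q (x j) = 0" if "j < n" "x j \<noteq> x i" for j
    unfolding q_def poly_prod using that by (intro prod_zero) auto
  have q_xi: "poly q (x i) \<noteq> 0"
    unfolding q_def poly_prod by auto
  have "(\<Sum>j<n. x j * poly q (x j)) = (\<Sum>j<n. \<Sum>k\<le>degree q. coeff q k * x j ^ Suc k)"
    by (simp add: poly_altdef sum_distrib_left mult_ac)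
  also have "\<dots> = (\<Sum>k\<le>degree q. coeff q k * (\<Sum>j<n. x j ^ Suc k))"
    by (subst sum.swap) (simp add: sum_distrib_left)
  also have "\<dots> = 0"
    by (intro sum.neutral ballI) (simp only: power_sums[OF zero_less_Suc] mult_zero_right)
  finally have "0 = (\<Sum>j<n. x j * poly q (x j))"
    by simp
  also have "\<dots> = (\<Sum>j | j < n \<and> x j = x i. x j * poly q (x j))"
    by (rule sum.mono_neutral_right) (use q_other in auto)
  also have "\<dots> = of_nat (card {j. j < n \<and> x j = x i}) * (x i * poly q (x i))"
    by simp
  finally have "card {j. j < n \<and> x j = x i} = 0"
    using xi q_xi by simp
  then show False
    using \<open>i < n\<close> by auto
qed

lemma mat_trace_nilpotent:
  fixes A :: "'a::alg_closed_field mat"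
  assumes A: "A \<in> carrier_mat n n" and "A ^\<^sub>m k = 0\<^sub>m n n"
  shows "mat_trace A = 0"
proof -
  obtain T where T: "T \<in> carrier_mat n n" "upper_triangular T" and sim: "similar_mat A T"
    using triangularizable[OF A] by blast
  have "T ^\<^sub>m k = 0\<^sub>m n n"
    by (rule similar_mat_pow_eq_0[OF similar_mat_sym[OF sim] T(1) assms(2)])
  then have "T $$ (i, i) = 0" if "i < n" for i
    using index_pow_upper_triangular[OF T that order_refl, of k] that by simp
  then show ?thesis
    using mat_trace_similar[OF sim] T(1) by (simp add: mat_trace_def)
qed

lemma nilpotent_if_mat_trace_pow_eq_0:
  fixes A :: "'a::{alg_closed_field, field_char_0} mat"
  assumes A: "A \<in> carrier_mat n n" and trace: "\<And>k. k > 0 \<Longrightarrow> mat_trace (A ^\<^sub>m k) = 0"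
  shows "A ^\<^sub>m n = 0\<^sub>m n n"
proof -
  obtain T where T: "T \<in> carrier_mat n n" "upper_triangular T" and sim: "similar_mat A T"
    using triangularizable[OF A] by blast
  have "(\<Sum>i<n. (T $$ (i, i)) ^ k) = 0" if "k > 0" for k
    using trace[OF that] mat_trace_pow_similar_triangular[OF sim T] by simp
  then have "T $$ (i, i) = 0" if "i < n" for i
    using eq_0_if_power_sums_eq_0[of "\<lambda>i. T $$ (i, i)" n] that by blast
  then have "T ^\<^sub>m n = 0\<^sub>m n n"
    using T by (intro eq_matI) (auto intro!: index_pow_strictly_upper_triangular)
  then show ?thesis
    by (rule similar_mat_pow_eq_0[OF sim A])
qed

subsection \<open>Determinants modulo ideals\<close>

interpretation ideal: Modules.module "(*) :: 'a::comm_ring_1 \<Rightarrow> 'a \<Rightarrow> 'a"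
  by unfold_locales (simp_all add: algebra_simps)

text \<open>As a simplification rule, this would loop with associativity.\<close>

declare ideal.scale_scale [simp del]

lemma sum_in_ideal_span: "(\<Sum>i\<in>S. c i * w i) \<in> ideal.span (w ` S)"
  by (intro ideal.span_sum ideal.span_scale ideal.span_base imageI)

lemma ideal_span_image_iff:
  assumes "finite S"
  shows "x \<in> ideal.span (w ` S) \<longleftrightarrow> (\<exists>c. x = (\<Sum>i\<in>S. c i * w i))"
proof
  assume "x \<in> ideal.span (w ` S)"
  then show "\<exists>c. x = (\<Sum>i\<in>S. c i * w i)"
  proof (induction rule: ideal.span_induct_alt)
    case base
    show ?case
      by (rule exI[of _ "\<lambda>_. 0"]) simp
  next
    case (step a y z)
    then obtain k c where k: "k \<in> S" "y = w k" and z: "z = (\<Sum>i\<in>S. c i * w i)"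
      by blast
    have "a * y + z = (\<Sum>i\<in>S. (if i = k then a * w i else 0) + c i * w i)"
      using k assms by (simp add: z sum.distrib)
    also have "\<dots> = (\<Sum>i\<in>S. (if i = k then a + c i else c i) * w i)"
      by (rule sum.cong) (auto simp: distrib_right)
    finally show ?case
      by (rule exI[of _ "\<lambda>i. if i = k then a + c i else c i"])
  qed
qed (auto intro: sum_in_ideal_span)

lemma prod_diff_in_ideal:
  assumes I: "ideal.subspace I" and "finite S" "\<And>i. i \<in> S \<Longrightarrow> f i - g i \<in> I"
  shows "prod f S - prod g S \<in> I"
  using assms(2,3)
proof (induction S rule: finite_induct)
  case empty
  show ?case
    using ideal.subspace_0[OF I] by simp
next
  case (insert x S)
  have "prod f (insert x S) - prod g (insert x S) =
      prod f S * (f x - g x) + g x * (prod f S - prod g S)"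
    using insert by (simp add: algebra_simps)
  also have "\<dots> \<in> I"
    using insert by (intro ideal.subspace_add[OF I] ideal.subspace_scale[OF I]) auto
  finally show ?case .
qed

lemma det_diff_in_ideal:
  assumes I: "ideal.subspace I" and A: "A \<in> carrier_mat n n" and B: "B \<in> carrier_mat n n"
    and diff: "\<And>i j. i < n \<Longrightarrow> j < n \<Longrightarrow> A $$ (i, j) - B $$ (i, j) \<in> I"
  shows "det A - det B \<in> I"
proof -
  have "det A - det B = (\<Sum>p | p permutes {0..<n}. signof p *
      ((\<Prod>i = 0..<n. A $$ (i, p i)) - (\<Prod>i = 0..<n. B $$ (i, p i))))"
    unfolding det_def'[OF A] det_def'[OF B] by (simp add: sum_subtractf right_diff_distrib)
  also have "\<dots> \<in> I"
  proof (intro ideal.subspace_sum[OF I] ideal.subspace_scale[OF I] prod_diff_in_ideal[OF I])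
    fix p i assume "p \<in> {p. p permutes {0..<n}}" "i \<in> {0..<n}"
    then show "A $$ (i, p i) - B $$ (i, p i) \<in> I"
      using permutes_in_image[of p "{0..<n}" i] by (intro diff) auto
  qed simp
  finally show ?thesis .
qed

lemma cramer_cofactor:
  assumes A: "A \<in> carrier_mat n n" and "b < n"
  shows "(\<Sum>i<n. cofactor A i b * (\<Sum>j<n. A $$ (i, j) * v j)) = det A * v b"
proof -
  have adj: "(\<Sum>i<n. cofactor A i b * A $$ (i, j)) = (if b = j then det A else 0)" if "j < n" for j
  proof -
    have "(\<Sum>i<n. cofactor A i b * A $$ (i, j)) = (adj_mat A * A) $$ (b, j)"
      using A \<open>b < n\<close> that by (simp add: adj_mat_def scalar_prod_def atLeast0LessThan)
    then show ?thesis
      using adj_mat(3)[OF A] \<open>b < n\<close> that by simp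
  qed
  have "(\<Sum>i<n. cofactor A i b * (\<Sum>j<n. A $$ (i, j) * v j)) =
      (\<Sum>j<n. (\<Sum>i<n. cofactor A i b * A $$ (i, j)) * v j)"
    unfolding sum_distrib_left sum_distrib_right by (subst sum.swap) (simp add: mult.assoc)
  also have "\<dots> = (\<Sum>j<n. if b = j then det A * v j else 0)"
    by (rule sum.cong) (auto simp: adj)
  also have "\<dots> = det A * v b"
    using \<open>b < n\<close> by simp
  finally show ?thesis .
qed

lemma det_mult_in_ideal:
  assumes I: "ideal.subspace I" and A: "A \<in> carrier_mat n n"
    and "\<And>i. i < n \<Longrightarrow> (\<Sum>j<n. A $$ (i, j) * v j) \<in> I" and "b < n"
  shows "det A * v b \<in> I"
  unfolding cramer_cofactor[OF A \<open>b < n\<close>, symmetric]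
  by (rule ideal.subspace_sum[OF I], rule ideal.subspace_scale[OF I]) (simp add: assms(3))

lemma det_mult_in_ideal_span:
  assumes M: "M \<in> carrier_mat n n" and "p \<in> ideal.span (f ` {..<n})"
    and g: "\<And>i. i < n \<Longrightarrow> g i = (\<Sum>k<n. M $$ (i, k) * f k)"
  shows "det M * p \<in> ideal.span (g ` {..<n})"
  using assms(2)
proof (induction rule: ideal.span_induct_alt)
  case (step c x y)
  then obtain k where k: "k < n" and x: "x = f k"
    by blast
  have det_M_x: "det M * x \<in> ideal.span (g ` {..<n})"
    unfolding x
    by (rule det_mult_in_ideal[OF ideal.subspace_span M _ k]) (auto simp flip: g intro: ideal.span_base)
  have "c * (det M * x) + det M * y \<in> ideal.span (g ` {..<n})"
    by (rule ideal.span_add[OF ideal.span_scale[OF det_M_x] step.IH])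
  then show ?case
    by (simp add: algebra_simps)
qed (simp add: ideal.span_zero)

definition regular_seq :: "nat \<Rightarrow> (nat \<Rightarrow> 'a::comm_ring_1) \<Rightarrow> bool" where
  "regular_seq n v \<longleftrightarrow>
    (\<forall>k<n. \<forall>r. r * v k \<in> ideal.span (v ` {..<k}) \<longrightarrow> r \<in> ideal.span (v ` {..<k}))"

text \<open>The syzygies of a regular sequence are generated by the Koszul relations.\<close>

lemma regular_seq_syzygy_in_ideal:
  assumes I: "ideal.subspace I" and "regular_seq n v" "(\<Sum>a<n. r a * v a) = 0"
    and "\<And>a b. a < n \<Longrightarrow> b < n \<Longrightarrow> v b * u a - v a * u b \<in> I"
  shows "(\<Sum>a<n. r a * u a) \<in> I"
  using assms(2-)
proof (induction n arbitrary: r)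
  case 0
  show ?case
    using ideal.subspace_0[OF I] by simp
next
  case (Suc n)
  have "r n * v n = (\<Sum>a<n. (- r a) * v a)"
    using Suc.prems(2) by (simp add: sum_negf eq_neg_iff_add_eq_0 add.commute)
  then have "r n * v n \<in> ideal.span (v ` {..<n})"
    by (simp only: sum_in_ideal_span)
  then have "r n \<in> ideal.span (v ` {..<n})"
    using Suc.prems(1) by (simp add: regular_seq_def)
  then obtain c where c: "r n = (\<Sum>a<n. c a * v a)"
    unfolding ideal_span_image_iff[OF finite_lessThan] by blast
  have "(\<Sum>a<n. (r a + c a * v n) * v a) = (\<Sum>a<n. r a * v a) + (\<Sum>a<n. c a * v a) * v n"
    by (simp add: algebra_simps sum.distrib sum_distrib_left)
  also have "\<dots> = 0"
    using Suc.prems(2) c by simp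
  finally have "(\<Sum>a<n. (r a + c a * v n) * u a) \<in> I"
    using Suc.prems by (intro Suc.IH) (auto simp: regular_seq_def)
  moreover have "(\<Sum>a<n. c a * (v a * u n - v n * u a)) \<in> I"
    using Suc.prems(3) by (intro ideal.subspace_sum[OF I] ideal.subspace_scale[OF I]) auto
  moreover have "(\<Sum>a<Suc n. r a * u a) =
      (\<Sum>a<n. (r a + c a * v n) * u a) + (\<Sum>a<n. c a * (v a * u n - v n * u a))"
    by (simp add: c algebra_simps sum.distrib sum_subtractf sum_distrib_left)
  ultimately show ?case
    by (simp only: ideal.subspace_add[OF I])
qed

lemma cofactor_cong_row:
  assumes "A \<in> carrier_mat n n" "B \<in> carrier_mat n n" "k < n" "j < n"
    and "\<And>i j. i < n \<Longrightarrow> j < n \<Longrightarrow> i \<noteq> k \<Longrightarrow> A $$ (i, j) = B $$ (i, j)"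
  shows "cofactor A k j = cofactor B k j"
proof -
  have "mat_delete A k j = mat_delete B k j"
    unfolding mat_delete_def using assms by (intro eq_matI) auto
  then show ?thesis
    by (simp add: cofactor_def)
qed

lemma cofactor_koszul_in_ideal:
  assumes I: "ideal.subspace I" and A: "A \<in> carrier_mat n n"
    and k: "k < n" and a: "a < n" and b: "b < n"
    and rows: "\<And>i. i < n \<Longrightarrow> i \<noteq> k \<Longrightarrow> (\<Sum>j<n. A $$ (i, j) * v j) \<in> I"
  shows "v b * cofactor A k a - v a * cofactor A k b \<in> I"
proof -
  define P where "P = mat n n (\<lambda>(i, j). if i = k then (if j = a then 1 else 0) else A $$ (i, j))"
  have P: "P \<in> carrier_mat n n"
    by (simp add: P_def)
  have cofactor_P: "cofactor P k j = cofactor A k j" if "j < n" for j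
    by (rule cofactor_cong_row[OF P A k that]) (auto simp: P_def)
  have P_k: "(\<Sum>j<n. P $$ (k, j) * x j) = x a" for x
  proof -
    have "(\<Sum>j<n. P $$ (k, j) * x j) = (\<Sum>j<n. if j = a then x j else 0)"
      by (rule sum.cong) (use k in \<open>auto simp: P_def\<close>)
    then show ?thesis
      using a by simp
  qed
  have det_P: "det P = cofactor A k a"
    using laplace_expansion_row[OF P k] P_k[of "\<lambda>j. cofactor P k j"] cofactor_P[OF a] by simp
  define u where "u i = (\<Sum>j<n. P $$ (i, j) * v j)" for i
  have "det P * v b = (\<Sum>i<n. cofactor P i b * u i)"
    unfolding u_def by (rule cramer_cofactor[OF P b, symmetric])
  also have "\<dots> = cofactor A k b * v a + (\<Sum>i\<in>{..<n} - {k}. cofactor P i b * u i)"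
    using k P_k[of v] cofactor_P[OF b] by (simp add: sum.remove[of "{..<n}" k] u_def)
  finally have "v b * cofactor A k a - v a * cofactor A k b = (\<Sum>i\<in>{..<n} - {k}. cofactor P i b * u i)"
    by (simp add: det_P mult.commute)
  also have "\<dots> \<in> I"
  proof (intro ideal.subspace_sum[OF I] ideal.subspace_scale[OF I])
    fix i assume "i \<in> {..<n} - {k}"
    then show "u i \<in> I"
      using rows[of i] by (simp add: u_def P_def)
  qed
  finally show ?thesis .
qed

lemma det_diff_row_in_ideal:
  assumes I: "ideal.subspace I" and reg: "regular_seq n v"
    and A: "A \<in> carrier_mat n n" and B: "B \<in> carrier_mat n n" and k: "k < n"
    and row_eq: "\<And>i j. i < n \<Longrightarrow> j < n \<Longrightarrow> i \<noteq> k \<Longrightarrow> A $$ (i, j) = B $$ (i, j)"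
    and rows: "\<And>i. i < n \<Longrightarrow> i \<noteq> k \<Longrightarrow> (\<Sum>j<n. A $$ (i, j) * v j) \<in> I"
    and row_k: "(\<Sum>j<n. A $$ (k, j) * v j) = (\<Sum>j<n. B $$ (k, j) * v j)"
  shows "det A - det B \<in> I"
proof -
  have "cofactor B k j = cofactor A k j" if "j < n" for j
    by (rule cofactor_cong_row[OF B A k that]) (simp add: row_eq)
  then have "det A - det B = (\<Sum>j<n. (A $$ (k, j) - B $$ (k, j)) * cofactor A k j)"
    unfolding laplace_expansion_row[OF A k] laplace_expansion_row[OF B k]
    by (simp add: left_diff_distrib sum_subtractf)
  also have "\<dots> \<in> I"
  proof (rule regular_seq_syzygy_in_ideal[OF I reg])
    show "(\<Sum>j<n. (A $$ (k, j) - B $$ (k, j)) * v j) = 0"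
      using row_k by (simp add: left_diff_distrib sum_subtractf)
    show "v b * cofactor A k a - v a * cofactor A k b \<in> I" if "a < n" "b < n" for a b
      by (rule cofactor_koszul_in_ideal[OF I A k that rows])
  qed
  finally show ?thesis .
qed

lemma det_diff_in_ideal_of_regular_seq:
  assumes I: "ideal.subspace I" and reg: "regular_seq n v"
    and A: "A \<in> carrier_mat n n" and B: "B \<in> carrier_mat n n"
    and rows: "\<And>i. i < n \<Longrightarrow> (\<Sum>j<n. A $$ (i, j) * v j) \<in> I"
    and rows_eq: "\<And>i. i < n \<Longrightarrow> (\<Sum>j<n. A $$ (i, j) * v j) = (\<Sum>j<n. B $$ (i, j) * v j)"
  shows "det A - det B \<in> I"
proof -
  define H where "H k = mat n n (\<lambda>(i, j). if i < k then B $$ (i, j) else A $$ (i, j))" for k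
  have H: "H k \<in> carrier_mat n n" for k
    by (simp add: H_def)
  have H_row: "(\<Sum>j<n. H k $$ (i, j) * v j) = (\<Sum>j<n. A $$ (i, j) * v j)" if "i < n" for i k
    using rows_eq[OF that] that by (cases "i < k") (simp_all add: H_def)
  have "det (H k) - det (H (Suc k)) \<in> I" if "k < n" for k
    by (rule det_diff_row_in_ideal[OF I reg H H that])
      (auto simp: H_row rows that, auto simp: H_def)
  then have "(\<Sum>k<n. det (H k) - det (H (Suc k))) \<in> I"
    by (intro ideal.subspace_sum[OF I]) auto
  moreover have "H 0 = A" "H n = B"
    using A B by (auto simp: H_def)
  ultimately show ?thesis
    using sum_lessThan_telescope'[of "\<lambda>k. det (H k)" n] by simp
qed

lemma det_on_image:
  assumes "finite S" and inj: "inj_on h S"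
  shows "det_on (h ` S) A = det_on S (\<lambda>i j. A (h i) (h j))"
proof -
  let ?\<phi> = "\<lambda>\<pi> x. if x \<in> h ` S then h (\<pi> (inv_into S h x)) else x"
  have bij: "bij_betw ?\<phi> {\<pi>. \<pi> permutes S} {\<pi>. \<pi> permutes h ` S}"
    by (rule bij_betw_permutations[OF inj_on_imp_bij_betw[OF inj]])
  have \<phi>: "?\<phi> \<pi> = map_permutation S h \<pi>" for \<pi>
    by (auto simp: map_permutation_def restrict_id_def fun_eq_iff)
  have "det_on (h ` S) A =
      (\<Sum>\<pi> | \<pi> permutes S. of_int (sign (?\<phi> \<pi>)) * (\<Prod>i\<in>S. A (h i) (?\<phi> \<pi> (h i))))"
    unfolding det_on_def sum.reindex_bij_betw[OF bij, symmetric] by (simp add: prod.reindex[OF inj])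
  also have "\<dots> = det_on S (\<lambda>i j. A (h i) (h j))"
    unfolding det_on_def \<phi>
    by (rule sum.cong)
      (simp_all add: sign_map_permutation[OF inj] map_permutation_apply[OF inj] assms)
  finally show ?thesis .
qed

lemma det_on_lessThan: "det_on {..<n} A = det (mat n n (\<lambda>(i, j). A i j))"
proof -
  have "(\<Prod>i<n. A i (p i)) = (\<Prod>i<n. mat n n (\<lambda>(i, j). A i j) $$ (i, p i))"
    if "p permutes {..<n}" for p
  proof (rule prod.cong[OF refl])
    fix i assume "i \<in> {..<n}"
    then show "A i (p i) = mat n n (\<lambda>(i, j). A i j) $$ (i, p i)"
      using permutes_in_image[OF that, of i] by simp
  qed
  then show ?thesis
    unfolding det_on_def by (subst det_def'[of _ n]) (auto simp: atLeast0LessThan intro!: sum.cong)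
qed

subsection \<open>Reproducing forms\<close>

text \<open>
  The form \<open>(x, y) \<mapsto> \<phi> (x * y)\<close> may be degenerate: its radical plays the role of zero, and the
  matrices below represent multiplications only up to the idempotent \<open>mult_matrix 1\<close>.
\<close>

locale reproducing_form = additive \<phi>
  for \<phi> :: "'r::comm_ring_1 \<Rightarrow> 'k::{alg_closed_field, field_char_0}" +
  fixes S :: "'r set" and n :: nat and a b :: "nat \<Rightarrow> 'r"
  assumes one_mem: "1 \<in> S" and mult_mem: "x \<in> S \<Longrightarrow> y \<in> S \<Longrightarrow> x * y \<in> S"
    and a_mem: "i < n \<Longrightarrow> a i \<in> S" and b_mem: "i < n \<Longrightarrow> b i \<in> S"
    and reproducing: "x \<in> S \<Longrightarrow> y \<in> S \<Longrightarrow> \<phi> (x * y) = (\<Sum>j<n. \<phi> (x * b j) * \<phi> (y * a j))"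
begin

definition casimir :: 'r where
  "casimir = (\<Sum>i<n. a i * b i)"

definition mult_matrix :: "'r \<Rightarrow> 'k mat" where
  "mult_matrix x = mat n n (\<lambda>(i, j). \<phi> (x * a i * b j))"

lemma mult_matrix_carrier: "mult_matrix x \<in> carrier_mat n n"
  by (simp add: mult_matrix_def)

lemma mult_matrix_mult:
  assumes "x \<in> S" "y \<in> S"
  shows "mult_matrix x * mult_matrix y = mult_matrix (x * y)"
proof (rule eq_matI)
  fix i l assume "i < dim_row (mult_matrix (x * y))" "l < dim_col (mult_matrix (x * y))"
  then have "i < n" "l < n"
    by (simp_all add: mult_matrix_def)
  then have "(mult_matrix x * mult_matrix y) $$ (i, l) =
      (\<Sum>j<n. \<phi> (x * a i * b j) * \<phi> (y * b l * a j))"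
    by (simp add: mult_matrix_def scalar_prod_def atLeast0LessThan mult_ac)
  also have "\<dots> = \<phi> (x * a i * (y * b l))"
    by (rule reproducing[symmetric])
      (use assms \<open>i < n\<close> \<open>l < n\<close> in \<open>auto intro: mult_mem a_mem b_mem\<close>)
  finally show "(mult_matrix x * mult_matrix y) $$ (i, l) = mult_matrix (x * y) $$ (i, l)"
    using \<open>i < n\<close> \<open>l < n\<close> by (simp add: mult_matrix_def mult_ac)
qed (auto simp: mult_matrix_def)

lemma power_mem: "x \<in> S \<Longrightarrow> x ^ k \<in> S"
  by (induction k) (auto intro: one_mem mult_mem)

lemma mult_matrix_power_Suc:
  assumes "x \<in> S"
  shows "mult_matrix x ^\<^sub>m Suc k = mult_matrix (x ^ Suc k)"
proof (induction k)
  case 0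
  show ?case
    using mult_matrix_carrier[of x] by simp
next
  case (Suc k)
  have "mult_matrix x ^\<^sub>m Suc (Suc k) = mult_matrix (x ^ Suc k) * mult_matrix x"
    by (simp only: pow_mat.simps(2)[of _ "Suc k"] Suc)
  also have "\<dots> = mult_matrix (x ^ Suc k * x)"
    by (rule mult_matrix_mult[OF power_mem[OF assms] assms])
  finally show ?case
    by (simp only: power_Suc2[of x "Suc k"])
qed

lemma mat_trace_mult_matrix: "mat_trace (mult_matrix x) = \<phi> (x * casimir)"
  by (simp add: mat_trace_def mult_matrix_def casimir_def sum_distrib_left sum mult.assoc)

lemma mult_matrix_eq_0_imp:
  assumes x: "x \<in> S" and y: "y \<in> S" and "mult_matrix x = 0\<^sub>m n n"
  shows "\<phi> (x * y) = 0"
proof -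
  have "\<phi> (x * a j) = 0" if "j < n" for j
  proof -
    have "\<phi> (x * a j * 1) = (\<Sum>i<n. \<phi> (x * a j * b i) * \<phi> (1 * a i))"
      by (rule reproducing) (use x a_mem[OF that] in \<open>auto intro: mult_mem one_mem\<close>)
    also have "\<dots> = (\<Sum>i<n. mult_matrix x $$ (j, i) * \<phi> (1 * a i))"
      using that by (simp add: mult_matrix_def)
    finally show ?thesis
      using assms(3) that by simp
  qed
  then show ?thesis
    using reproducing[OF y x] by (simp add: mult.commute)
qed

lemma nilpotent_if_casimir_annihilates:
  assumes x: "x \<in> S" and annihilates: "\<forall>y\<in>S. \<phi> (x * casimir * y) = 0"
  shows "\<exists>k. \<forall>y\<in>S. \<phi> (x ^ k * y) = 0"
proof -
  have "mat_trace (mult_matrix x ^\<^sub>m k) = 0" if pos: "k > 0" for k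
  proof -
    obtain l where k: "k = Suc l"
      using pos by (metis gr0_implies_Suc)
    have "\<phi> (x * casimir * x ^ l) = 0"
      using annihilates power_mem[OF x] by blast
    then show ?thesis
      unfolding k mult_matrix_power_Suc[OF x] mat_trace_mult_matrix by (simp add: mult_ac)
  qed
  then have "mult_matrix x ^\<^sub>m Suc n = 0\<^sub>m n n"
    using nilpotent_if_mat_trace_pow_eq_0[OF mult_matrix_carrier] mult_matrix_carrier[of x] by simp
  then have "mult_matrix (x ^ Suc n) = 0\<^sub>m n n"
    by (simp only: mult_matrix_power_Suc[OF x])
  then show ?thesis
    using mult_matrix_eq_0_imp[OF power_mem[OF x]] by blast
qed

lemma casimir_annihilates_if_nilpotent:
  assumes x: "x \<in> S" and nilpotent: "\<forall>y\<in>S. \<phi> (x ^ k * y) = 0" and y: "y \<in> S"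
  shows "\<phi> (x * casimir * y) = 0"
proof -
  have "\<phi> ((x * y) ^ Suc k * a i * b j) = 0" if "i < n" "j < n" for i j
  proof -
    have "x * y ^ Suc k * a i * b j \<in> S"
      using that by (intro mult_mem power_mem x y a_mem b_mem)
    then have "\<phi> (x ^ k * (x * y ^ Suc k * a i * b j)) = 0"
      using nilpotent by blast
    then show ?thesis
      by (simp add: power_mult_distrib mult_ac)
  qed
  then have "mult_matrix (x * y) ^\<^sub>m Suc k = 0\<^sub>m n n"
    unfolding mult_matrix_power_Suc[OF mult_mem[OF x y]] by (auto simp: mult_matrix_def)
  then have "\<phi> (x * y * casimir) = 0"
    using mat_trace_nilpotent[OF mult_matrix_carrier] by (simp only: mat_trace_mult_matrix)
  then show ?thesis
    by (simp only: mult_ac)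
qed

lemma casimir_annihilator_iff:
  "x \<in> S \<Longrightarrow> (\<forall>y\<in>S. \<phi> (x * casimir * y) = 0) \<longleftrightarrow> (\<exists>k. \<forall>y\<in>S. \<phi> (x ^ k * y) = 0)"
  using nilpotent_if_casimir_annihilates casimir_annihilates_if_nilpotent by blast

end

subsection \<open>Linear maps on polynomials\<close>

interpretation mconst: comm_ring_hom "mconst :: 'a::comm_ring_1 \<Rightarrow> 'a mpoly"
  by unfold_locales (simp_all add: mconst_def single_add mult_single)

lemma mconst_mult_single: "mconst c * Poly_Mapping.single \<alpha> d = Poly_Mapping.single \<alpha> (c * d)"
  by (simp add: mconst_def mult_single)

lemma mmonom_add: "mmonom (\<alpha> + \<beta>) = mmonom \<alpha> * mmonom \<beta>"
  by (simp add: mmonom_def mult_single)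

lemma mmonom_0 [simp]: "mmonom 0 = 1"
  by (simp add: mmonom_def)

lemma mmonom_sum: "mmonom (sum f S) = (\<Prod>i\<in>S. mmonom (f i))"
  by (induction S rule: infinite_finite_induct) (auto simp: mmonom_add)

lemma mvar_eq_mmonom: "mvar k = mmonom (Poly_Mapping.single k 1)"
  by (simp add: mvar_def mmonom_def)

lemma mvar_power: "mvar k ^ n = mmonom (Poly_Mapping.single k n)"
  by (induction n) (auto simp: mvar_def mmonom_def mult_single single_add[symmetric])

lemma mmonom_eq_prod_mvar:
  "mmonom \<alpha> = (\<Prod>k\<in>Poly_Mapping.keys \<alpha>. mvar k ^ Poly_Mapping.lookup \<alpha> k)"
proof -
  have "\<alpha> = (\<Sum>k\<in>Poly_Mapping.keys \<alpha>. Poly_Mapping.single k (Poly_Mapping.lookup \<alpha> k))"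
    by (rule poly_mapping_eqI) (simp add: lookup_sum lookup_single when_def in_keys_iff)
  then have "mmonom \<alpha> =
      mmonom (\<Sum>k\<in>Poly_Mapping.keys \<alpha>. Poly_Mapping.single k (Poly_Mapping.lookup \<alpha> k))"
    by (rule arg_cong)
  then show ?thesis
    by (simp only: mmonom_sum mvar_power)
qed

lemma mpoly_eq_sum_mmonom:
  "p = (\<Sum>\<alpha>\<in>Poly_Mapping.keys p. mconst (Poly_Mapping.lookup p \<alpha>) * mmonom \<alpha>)"
  by (rule poly_mapping_eqI)
    (simp add: mmonom_def mconst_mult_single lookup_sum lookup_single when_def in_keys_iff)

lemma mpoly_monom_induct [case_names monom zero add]:
  assumes "\<And>\<alpha> c. \<alpha> \<in> Poly_Mapping.keys p \<Longrightarrow> P (mconst c * mmonom \<alpha>)"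
    and "P 0" and "\<And>p q. P p \<Longrightarrow> P q \<Longrightarrow> P (p + q)"
  shows "P p"
proof -
  have "P (\<Sum>\<alpha>\<in>S. mconst (Poly_Mapping.lookup p \<alpha>) * mmonom \<alpha>)"
    if "finite S" "S \<subseteq> Poly_Mapping.keys p" for S
    using that by (induction S rule: finite_induct) (auto intro: assms)
  from this[OF finite_keys order_refl] show ?thesis
    by (simp flip: mpoly_eq_sum_mmonom)
qed

definition lin_ext :: "((nat \<Rightarrow>\<^sub>0 nat) \<Rightarrow> 'a::comm_ring_1 mpoly) \<Rightarrow> 'a mpoly \<Rightarrow> 'a mpoly" where
  "lin_ext \<phi> p = (\<Sum>\<alpha>\<in>Poly_Mapping.keys p. mconst (Poly_Mapping.lookup p \<alpha>) * \<phi> \<alpha>)"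

definition functional :: "((nat \<Rightarrow>\<^sub>0 nat) \<Rightarrow> 'a::comm_ring_1) \<Rightarrow> 'a mpoly \<Rightarrow> 'a" where
  "functional t p = (\<Sum>\<alpha>\<in>Poly_Mapping.keys p. Poly_Mapping.lookup p \<alpha> * t \<alpha>)"

interpretation lin_ext: additive "lin_ext \<phi>" for \<phi>
  unfolding lin_ext_def
  by unfold_locales (rule setsum_keys_plus_distrib, simp_all add: mconst.hom_add distrib_right)

interpretation functional: additive "functional t" for t
  unfolding functional_def
  by unfold_locales (rule setsum_keys_plus_distrib, simp_all add: distrib_right)

lemma lin_ext_superset:
  assumes "finite S" "Poly_Mapping.keys p \<subseteq> S"
  shows "lin_ext \<phi> p = (\<Sum>\<alpha>\<in>S. mconst (Poly_Mapping.lookup p \<alpha>) * \<phi> \<alpha>)"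
  unfolding lin_ext_def
  by (rule sum.mono_neutral_left) (use assms in \<open>auto simp: in_keys_iff\<close>)

lemma lin_ext_mmonom: "lin_ext \<phi> (mmonom \<alpha>) = \<phi> \<alpha>"
  by (simp add: lin_ext_def mmonom_def)

lemma lin_ext_mconst_mmonom: "lin_ext \<phi> (mconst c * mmonom \<alpha>) = mconst c * \<phi> \<alpha>"
  by (simp add: lin_ext_def mmonom_def mconst_mult_single)

lemma lin_ext_mconst_mult: "lin_ext \<phi> (mconst c * p) = mconst c * lin_ext \<phi> p"
proof (induction p rule: mpoly_monom_induct)
  case (monom \<alpha> d)
  show ?case
    using lin_ext_mconst_mmonom[of \<phi> "c * d" \<alpha>]
    by (simp add: lin_ext_mconst_mmonom mconst.hom_mult mult.assoc)
qed (simp_all add: lin_ext.zero lin_ext.add distrib_left)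

lemma functional_mmonom: "functional t (mmonom \<alpha>) = t \<alpha>"
  by (simp add: functional_def mmonom_def)

lemma functional_mconst_mmonom: "functional t (mconst c * mmonom \<alpha>) = c * t \<alpha>"
  by (simp add: functional_def mmonom_def mconst_mult_single)

lemma functional_mconst_mult: "functional t (mconst c * p) = c * functional t p"
proof (induction p rule: mpoly_monom_induct)
  case (monom \<alpha> d)
  show ?case
    using functional_mconst_mmonom[of t "c * d" \<alpha>]
    by (simp add: functional_mconst_mmonom mconst.hom_mult mult.assoc)
qed (simp_all add: functional.zero functional.add distrib_left)

lemma functional_mult: "functional t (p * q) = functional (\<lambda>\<beta>. functional t (p * mmonom \<beta>)) q"
proof (induction q rule: mpoly_monom_induct)
  case (monom \<alpha> c)
  show ?case
    by (simp add: mult.left_commute[of p] functional_mconst_mult functional_mmonom)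
qed (auto simp: distrib_left functional.zero functional.add)

subsection \<open>Polynomials in the first variables\<close>

lemma polys_in_mmonom: "Poly_Mapping.keys \<alpha> \<subseteq> {..<n} \<Longrightarrow> mmonom \<alpha> \<in> polys_in n"
  by (simp add: polys_in_def mmonom_def)

lemma polys_in_0: "0 \<in> polys_in n"
  by (simp add: polys_in_def)

lemma polys_in_1: "1 \<in> polys_in n"
  by (simp add: polys_in_def)

lemma polys_in_mconst: "mconst c \<in> polys_in n"
  by (simp add: polys_in_def mconst_def)

lemma polys_in_mvar: "k < n \<Longrightarrow> mvar k \<in> polys_in n"
  by (simp add: polys_in_def mvar_def)

lemma polys_in_add: "p \<in> polys_in n \<Longrightarrow> q \<in> polys_in n \<Longrightarrow> p + q \<in> polys_in n"
  using Poly_Mapping.keys_add[of p q] by (fastforce simp: polys_in_def)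

lemma polys_in_mult:
  assumes "p \<in> polys_in n" "q \<in> polys_in n"
  shows "p * q \<in> polys_in n"
  unfolding polys_in_def
proof (intro CollectI ballI)
  fix \<alpha> assume "\<alpha> \<in> Poly_Mapping.keys (p * q)"
  then obtain \<beta> \<gamma> where "\<alpha> = \<beta> + \<gamma>" "\<beta> \<in> Poly_Mapping.keys p" "\<gamma> \<in> Poly_Mapping.keys q"
    using keys_mult[of p q] by auto
  then show "Poly_Mapping.keys \<alpha> \<subseteq> {..<n}"
    using assms Poly_Mapping.keys_add[of \<beta> \<gamma>] by (fastforce simp: polys_in_def)
qed

lemma polys_in_uminus: "p \<in> polys_in n \<Longrightarrow> - p \<in> polys_in n"
  by (simp add: polys_in_def)

lemma polys_in_diff: "p \<in> polys_in n \<Longrightarrow> q \<in> polys_in n \<Longrightarrow> p - q \<in> polys_in n"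
  using polys_in_add[of p n "- q"] by (simp add: polys_in_uminus)

lemma polys_in_sum: "(\<And>i. i \<in> S \<Longrightarrow> f i \<in> polys_in n) \<Longrightarrow> sum f S \<in> polys_in n"
  by (induction S rule: infinite_finite_induct) (auto intro: polys_in_0 polys_in_add)

lemma polys_in_prod: "(\<And>i. i \<in> S \<Longrightarrow> f i \<in> polys_in n) \<Longrightarrow> prod f S \<in> polys_in n"
  by (induction S rule: infinite_finite_induct) (auto intro: polys_in_1 polys_in_mult)

lemma polys_in_power: "p \<in> polys_in n \<Longrightarrow> p ^ k \<in> polys_in n"
  by (induction k) (auto intro: polys_in_1 polys_in_mult)

lemma polys_in_of_int: "of_int z \<in> polys_in n"
  using polys_in_mconst[of "of_int z"] by (simp add: mconst.hom_of_int)

lemmas polys_in_intros = polys_in_0 polys_in_1 polys_in_mconst polys_in_mvar polys_in_mmonom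
  polys_in_add polys_in_mult polys_in_uminus polys_in_diff polys_in_sum polys_in_prod polys_in_power
  polys_in_of_int

lemma polys_in_mono: "n \<le> n' \<Longrightarrow> p \<in> polys_in n \<Longrightarrow> p \<in> polys_in n'"
  unfolding polys_in_def by fastforce

lemma polys_in_det:
  assumes "A \<in> carrier_mat m m" "\<And>i j. i < m \<Longrightarrow> j < m \<Longrightarrow> A $$ (i, j) \<in> polys_in n"
  shows "det A \<in> polys_in n"
  unfolding det_def'[OF assms(1)]
proof (intro polys_in_sum polys_in_mult polys_in_prod)
  fix p i assume "p \<in> {p. p permutes {0..<m}}" "i \<in> {0..<m}"
  then show "A $$ (i, p i) \<in> polys_in n"
    using permutes_in_image[of p "{0..<m}" i] by (intro assms(2)) auto
qed (rule polys_in_of_int)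

lemma in_some_polys_in: "\<exists>n. p \<in> polys_in n"
proof -
  have "finite (\<Union>\<alpha>\<in>Poly_Mapping.keys p. Poly_Mapping.keys \<alpha>)"
    by auto
  then obtain n where "\<forall>k\<in>(\<Union>\<alpha>\<in>Poly_Mapping.keys p. Poly_Mapping.keys \<alpha>). k < n"
    using finite_nat_set_iff_bounded by blast
  then show ?thesis
    by (intro exI[of _ n]) (auto simp: polys_in_def)
qed

lemma polys_in_induct [consumes 1, case_names const var add mult]:
  assumes "p \<in> polys_in n"
    and const: "\<And>c. P (mconst c)" and var: "\<And>k. k < n \<Longrightarrow> P (mvar k)"
    and add: "\<And>p q. p \<in> polys_in n \<Longrightarrow> q \<in> polys_in n \<Longrightarrow> P p \<Longrightarrow> P q \<Longrightarrow> P (p + q)"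
    and mult: "\<And>p q. p \<in> polys_in n \<Longrightarrow> q \<in> polys_in n \<Longrightarrow> P p \<Longrightarrow> P q \<Longrightarrow> P (p * q)"
  shows "P p"
proof -
  have power: "P (mvar k ^ i)" if "k < n" for k i
    using that const[of 1] by (induction i) (auto intro: mult var polys_in_intros)
  have prod: "P (\<Prod>k\<in>S. mvar k ^ e k)" if "S \<subseteq> {..<n}" for S e
    using that const[of 1]
    by (induction S rule: infinite_finite_induct) (auto intro!: mult power polys_in_intros)
  have "p \<in> polys_in n \<and> P p"
  proof (induction p rule: mpoly_monom_induct)
    case (monom \<alpha> c)
    then have "Poly_Mapping.keys \<alpha> \<subseteq> {..<n}"
      using assms(1) by (auto simp: polys_in_def)
    then show ?case
      using prod by (auto intro!: mult const polys_in_intros simp: mmonom_eq_prod_mvar[of \<alpha>])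
  next
    case zero
    then show ?case
      using const[of 0] by (simp add: polys_in_0)
  qed (auto intro: add polys_in_add)
  then show ?thesis ..
qed

lemma mpoly_induct [case_names const var add mult]:
  assumes "\<And>c. P (mconst c)" "\<And>k. P (mvar k)"
    and "\<And>p q. P p \<Longrightarrow> P q \<Longrightarrow> P (p + q)" "\<And>p q. P p \<Longrightarrow> P q \<Longrightarrow> P (p * q)"
  shows "P p"
proof -
  obtain n where "p \<in> polys_in n"
    using in_some_polys_in by blast
  then show ?thesis
    by (induction rule: polys_in_induct) (auto intro: assms)
qed

subsection \<open>Substitution and partial derivatives\<close>

lemma msubst_eq_lin_ext:
  "msubst \<sigma> = lin_ext (\<lambda>\<alpha>. \<Prod>k\<in>Poly_Mapping.keys \<alpha>. \<sigma> k ^ Poly_Mapping.lookup \<alpha> k)"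
  by (rule ext) (simp add: msubst_def lin_ext_def)

lemma msubst_mmonom_superset:
  assumes "finite S" "Poly_Mapping.keys \<alpha> \<subseteq> S"
  shows "msubst \<sigma> (mmonom \<alpha>) = (\<Prod>k\<in>S. \<sigma> k ^ Poly_Mapping.lookup \<alpha> k)"
  unfolding msubst_eq_lin_ext lin_ext_mmonom
  by (rule prod.mono_neutral_left) (use assms in \<open>auto simp: in_keys_iff\<close>)

lemma msubst_mmonom_add: "msubst \<sigma> (mmonom (\<alpha> + \<beta>)) = msubst \<sigma> (mmonom \<alpha>) * msubst \<sigma> (mmonom \<beta>)"
proof -
  let ?S = "Poly_Mapping.keys \<alpha> \<union> Poly_Mapping.keys \<beta>"
  have "msubst \<sigma> (mmonom (\<alpha> + \<beta>)) = (\<Prod>k\<in>?S. \<sigma> k ^ Poly_Mapping.lookup (\<alpha> + \<beta>) k)"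
    by (rule msubst_mmonom_superset) (use Poly_Mapping.keys_add[of \<alpha> \<beta>] in auto)
  then show ?thesis
    by (simp add: msubst_mmonom_superset[of ?S] lookup_add power_add prod.distrib)
qed

lemma msubst_mconst [simp]: "msubst \<sigma> (mconst c) = mconst c"
  using lin_ext_mconst_mmonom[of _ c 0] by (simp add: msubst_eq_lin_ext)

lemma msubst_mvar [simp]: "msubst \<sigma> (mvar k) = \<sigma> k"
  by (simp add: mvar_eq_mmonom msubst_mmonom_superset[of "{k}"])

lemma msubst_mult: "msubst \<sigma> (p * q) = msubst \<sigma> p * msubst \<sigma> q"
proof (induction p rule: mpoly_monom_induct)
  case (monom \<alpha> c)
  show ?case
  proof (induction q rule: mpoly_monom_induct)
    case (monom \<beta> d)
    have "mconst c * mmonom \<alpha> * (mconst d * mmonom \<beta>) = mconst c * (mconst d * mmonom (\<alpha> + \<beta>))"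
      by (simp add: mmonom_add mult_ac)
    then show ?case
      using msubst_mmonom_add[of \<sigma> \<alpha> \<beta>] by (simp add: msubst_eq_lin_ext lin_ext_mconst_mult mult_ac)
  qed (simp_all add: msubst_eq_lin_ext lin_ext.zero lin_ext.add distrib_left)
qed (simp_all add: msubst_eq_lin_ext lin_ext.zero lin_ext.add distrib_right)

interpretation msubst: comm_ring_hom "msubst \<sigma>" for \<sigma>
proof
  show "msubst \<sigma> 1 = 1"
    using msubst_mconst[of \<sigma> 1] by simp
qed (simp_all add: msubst_mult, simp_all add: msubst_eq_lin_ext lin_ext.zero lin_ext.add)

lemma polys_in_msubst:
  assumes "p \<in> polys_in m" "\<And>k. k < m \<Longrightarrow> \<sigma> k \<in> polys_in n"
  shows "msubst \<sigma> p \<in> polys_in n"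
  using assms(1)
  by (induction rule: polys_in_induct)
    (auto simp: msubst.hom_add msubst.hom_mult assms(2) intro: polys_in_intros)

lemma msubst_cong:
  assumes "p \<in> polys_in m" "\<And>k. k < m \<Longrightarrow> \<sigma> k = \<rho> k"
  shows "msubst \<sigma> p = msubst \<rho> p"
  using assms(1)
  by (induction rule: polys_in_induct) (auto simp: msubst.hom_add msubst.hom_mult assms(2))

lemma msubst_mvar_id: "msubst mvar p = p"
  by (induction p rule: mpoly_induct) (simp_all add: msubst.hom_add msubst.hom_mult)

lemma msubst_msubst: "msubst \<sigma> (msubst \<rho> p) = msubst (\<lambda>k. msubst \<sigma> (\<rho> k)) p"
  by (induction p rule: mpoly_induct) (simp_all add: msubst.hom_add msubst.hom_mult)

lemma msubst_diff_in_ideal: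
  assumes I: "ideal.subspace I" and "\<And>k. \<sigma> k - \<rho> k \<in> I"
  shows "msubst \<sigma> p - msubst \<rho> p \<in> I"
proof (induction p rule: mpoly_induct)
  case (add p q)
  have "msubst \<sigma> (p + q) - msubst \<rho> (p + q) = (msubst \<sigma> p - msubst \<rho> p) + (msubst \<sigma> q - msubst \<rho> q)"
    by (simp add: msubst.hom_add)
  then show ?case
    using add by (simp only: ideal.subspace_add[OF I])
next
  case (mult p q)
  have "msubst \<sigma> (p * q) - msubst \<rho> (p * q) =
      msubst \<sigma> p * (msubst \<sigma> q - msubst \<rho> q) + msubst \<rho> q * (msubst \<sigma> p - msubst \<rho> p)"
    by (simp add: msubst.hom_mult algebra_simps)
  then show ?case
    using mult by (simp only: ideal.subspace_add[OF I] ideal.subspace_scale[OF I])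
qed (simp_all add: assms(2) ideal.subspace_0[OF I])

definition monom_deriv :: "nat \<Rightarrow> (nat \<Rightarrow>\<^sub>0 nat) \<Rightarrow> 'a::comm_ring_1 mpoly" where
  "monom_deriv k \<alpha> =
     Poly_Mapping.single (\<alpha> - Poly_Mapping.single k 1) (of_nat (Poly_Mapping.lookup \<alpha> k))"

lemma mpderiv_eq_lin_ext: "mpderiv k = lin_ext (monom_deriv k)"
  by (rule ext) (simp add: mpderiv_def lin_ext_def monom_deriv_def mconst_mult_single mult.commute)

lemma mmonom_mult_monom_deriv:
  "mmonom \<beta> * monom_deriv k \<alpha> =
     Poly_Mapping.single (\<alpha> + \<beta> - Poly_Mapping.single k 1) (of_nat (Poly_Mapping.lookup \<alpha> k))"
proof (cases "Poly_Mapping.lookup \<alpha> k = 0")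
  case True
  then show ?thesis
    by (simp add: monom_deriv_def)
next
  case False
  have "\<beta> + (\<alpha> - Poly_Mapping.single k 1) = \<alpha> + \<beta> - Poly_Mapping.single k 1"
    by (rule poly_mapping_eqI)
      (use False in \<open>auto simp: lookup_add lookup_minus lookup_single when_def\<close>)
  then show ?thesis
    by (simp add: monom_deriv_def mmonom_def mult_single)
qed

lemma monom_deriv_add:
  "monom_deriv k (\<alpha> + \<beta>) = mmonom \<beta> * monom_deriv k \<alpha> + mmonom \<alpha> * monom_deriv k \<beta>"
  unfolding mmonom_mult_monom_deriv
  by (simp add: add.commute[of \<beta>] monom_deriv_def lookup_add single_add)

lemma mpderiv_add: "mpderiv k (p + q) = mpderiv k p + mpderiv k q"
  by (simp add: mpderiv_eq_lin_ext lin_ext.add)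

lemma mpderiv_mult: "mpderiv k (p * q) = mpderiv k p * q + p * mpderiv k q"
proof (induction p rule: mpoly_monom_induct)
  case (monom \<alpha> c)
  show ?case
  proof (induction q rule: mpoly_monom_induct)
    case (monom \<beta> d)
    have "mconst c * mmonom \<alpha> * (mconst d * mmonom \<beta>) = mconst c * (mconst d * mmonom (\<alpha> + \<beta>))"
      by (simp add: mmonom_add mult_ac)
    then show ?case
      by (simp add: mpderiv_eq_lin_ext lin_ext_mconst_mult lin_ext_mmonom monom_deriv_add algebra_simps)
  qed (simp_all add: mpderiv_eq_lin_ext lin_ext.zero lin_ext.add algebra_simps)
qed (simp_all add: mpderiv_eq_lin_ext lin_ext.zero lin_ext.add algebra_simps)

lemma mpderiv_mconst: "mpderiv k (mconst c) = 0"
  by (simp add: mpderiv_def mconst_def)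

lemma mpderiv_mvar: "mpderiv k (mvar l) = (if l = k then 1 else 0)"
  by (simp add: mvar_eq_mmonom mpderiv_eq_lin_ext lin_ext_mmonom monom_deriv_def lookup_single when_def)

lemma polys_in_mpderiv: "p \<in> polys_in n \<Longrightarrow> mpderiv k p \<in> polys_in n"
  by (induction rule: polys_in_induct)
    (auto simp: mpderiv_add mpderiv_mult mpderiv_mconst mpderiv_mvar intro: polys_in_intros)

subsection \<open>Functionals acting on the second group of variables\<close>

definition xpart :: "nat \<Rightarrow> (nat \<Rightarrow>\<^sub>0 nat) \<Rightarrow> (nat \<Rightarrow>\<^sub>0 nat)" where
  "xpart m \<gamma> = (\<Sum>k<m. Poly_Mapping.single k (Poly_Mapping.lookup \<gamma> k))"

definition ypart :: "nat \<Rightarrow> (nat \<Rightarrow>\<^sub>0 nat) \<Rightarrow> (nat \<Rightarrow>\<^sub>0 nat)" where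
  "ypart m \<gamma> = (\<Sum>k<m. Poly_Mapping.single k (Poly_Mapping.lookup \<gamma> (m + k)))"

lemma lookup_xpart:
  "Poly_Mapping.lookup (xpart m \<gamma>) j = (if j < m then Poly_Mapping.lookup \<gamma> j else 0)"
  by (simp add: xpart_def lookup_sum lookup_single when_def)

lemma lookup_ypart:
  "Poly_Mapping.lookup (ypart m \<gamma>) j = (if j < m then Poly_Mapping.lookup \<gamma> (m + j) else 0)"
  by (simp add: ypart_def lookup_sum lookup_single when_def)

lemma lookup_yshift:
  "Poly_Mapping.lookup (yshift m \<beta>) j = (if m \<le> j then Poly_Mapping.lookup \<beta> (j - m) else 0)"
proof -
  have "Poly_Mapping.lookup (yshift m \<beta>) j =
      (\<Sum>k\<in>Poly_Mapping.keys \<beta>. if m \<le> j \<and> k = j - m then Poly_Mapping.lookup \<beta> k else 0)"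
    unfolding yshift_def lookup_sum by (rule sum.cong) (auto simp: lookup_single when_def)
  also have "\<dots> = (if m \<le> j then Poly_Mapping.lookup \<beta> (j - m) else 0)"
    by (cases "m \<le> j") (simp_all add: in_keys_iff)
  finally show ?thesis .
qed

lemma keys_subset_lessThan_iff:
  fixes \<alpha> :: "nat \<Rightarrow>\<^sub>0 nat"
  shows "Poly_Mapping.keys \<alpha> \<subseteq> {..<m} \<longleftrightarrow> (\<forall>j\<ge>m. Poly_Mapping.lookup \<alpha> j = 0)"
  by (auto simp: in_keys_iff subset_iff) (metis leI less_irrefl)

lemma keys_xpart: "Poly_Mapping.keys (xpart m \<gamma>) \<subseteq> {..<m}"
  by (simp add: keys_subset_lessThan_iff lookup_xpart)

lemma keys_ypart: "Poly_Mapping.keys (ypart m \<gamma>) \<subseteq> {..<m}"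
  by (simp add: keys_subset_lessThan_iff lookup_ypart)

lemma xpart_add_left:
  "Poly_Mapping.keys \<alpha> \<subseteq> {..<m} \<Longrightarrow> xpart m (\<alpha> + \<gamma>) = \<alpha> + xpart m \<gamma>"
  by (rule poly_mapping_eqI) (simp add: lookup_xpart lookup_add keys_subset_lessThan_iff)

lemma ypart_add_left:
  "Poly_Mapping.keys \<alpha> \<subseteq> {..<m} \<Longrightarrow> ypart m (\<alpha> + \<gamma>) = ypart m \<gamma>"
  by (rule poly_mapping_eqI) (simp add: lookup_ypart lookup_add keys_subset_lessThan_iff)

lemma xpart_add_yshift: "xpart m (yshift m \<beta> + \<gamma>) = xpart m \<gamma>"
  by (rule poly_mapping_eqI) (simp add: lookup_xpart lookup_add lookup_yshift)

lemma ypart_add_yshift: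
  "Poly_Mapping.keys \<beta> \<subseteq> {..<m} \<Longrightarrow> ypart m (yshift m \<beta> + \<gamma>) = \<beta> + ypart m \<gamma>"
  by (rule poly_mapping_eqI)
    (simp add: lookup_ypart lookup_add lookup_yshift keys_subset_lessThan_iff)

lemma xpart_0 [simp]: "xpart m 0 = 0"
  by (simp add: xpart_def)

lemma ypart_0 [simp]: "ypart m 0 = 0"
  by (simp add: ypart_def)

lemma xpart_plus_yshift_ypart:
  "Poly_Mapping.keys \<gamma> \<subseteq> {..<2 * m} \<Longrightarrow> xpart m \<gamma> + yshift m (ypart m \<gamma>) = \<gamma>"
  by (rule poly_mapping_eqI)
    (auto simp: lookup_add lookup_xpart lookup_ypart lookup_yshift keys_subset_lessThan_iff not_less)

definition to_y :: "nat \<Rightarrow> 'a::comm_ring_1 mpoly \<Rightarrow> 'a mpoly" where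
  "to_y m = msubst (\<lambda>k. mvar (m + k))"

definition diag :: "nat \<Rightarrow> 'a::comm_ring_1 mpoly \<Rightarrow> 'a mpoly" where
  "diag m = msubst (\<lambda>k. if k < m then mvar k else mvar (k - m))"

interpretation to_y: comm_ring_hom "to_y m" for m
  unfolding to_y_def ..

interpretation diag: comm_ring_hom "diag m" for m
  unfolding diag_def ..

lemma to_y_mconst: "to_y m (mconst c) = mconst c"
  by (simp add: to_y_def)

lemma to_y_mvar: "to_y m (mvar k) = mvar (m + k)"
  by (simp add: to_y_def)

lemma to_y_mmonom: "to_y m (mmonom \<alpha>) = mmonom (yshift m \<alpha>)"
  unfolding mmonom_eq_prod_mvar[of \<alpha>] to_y.hom_prod to_y.hom_power to_y_mvar
  by (simp add: mvar_power yshift_def mmonom_sum)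

lemma diag_eq_self: "p \<in> polys_in m \<Longrightarrow> diag m p = p"
  unfolding diag_def by (subst msubst_cong[of p m _ mvar]) (simp_all add: msubst_mvar_id)

lemma diag_to_y: "diag m (to_y m p) = p"
  unfolding diag_def to_y_def msubst_msubst by (simp add: msubst_mvar_id)

definition yapply :: "nat \<Rightarrow> ((nat \<Rightarrow>\<^sub>0 nat) \<Rightarrow> 'a::comm_ring_1) \<Rightarrow> 'a mpoly \<Rightarrow> 'a mpoly" where
  "yapply m t = lin_ext (\<lambda>\<gamma>. mconst (t (ypart m \<gamma>)) * mmonom (xpart m \<gamma>))"

interpretation yapply: additive "yapply m t" for m t
  unfolding yapply_def ..

lemma yapply_mconst_mmonom:
  "yapply m t (mconst c * mmonom \<gamma>) = mconst (c * t (ypart m \<gamma>)) * mmonom (xpart m \<gamma>)"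
  by (simp add: yapply_def lin_ext_mconst_mmonom mconst.hom_mult mult.assoc)

lemma yapply_1: "yapply m t 1 = mconst (t 0)"
  using yapply_mconst_mmonom[of m t 1 0] by simp

lemma yapply_eq_0:
  assumes "\<And>\<beta>. Poly_Mapping.keys \<beta> \<subseteq> {..<m} \<Longrightarrow> t \<beta> = 0"
  shows "yapply m t F = 0"
  by (simp add: yapply_def lin_ext_def assms keys_ypart)

lemma polys_in_yapply: "yapply m t F \<in> polys_in m"
  unfolding yapply_def lin_ext_def by (intro polys_in_intros keys_xpart)

lemma yapply_x_mult:
  assumes "p \<in> polys_in m"
  shows "yapply m t (p * F) = p * yapply m t F"
proof (induction p rule: mpoly_monom_induct)
  case (monom \<alpha> c)
  then have \<alpha>: "Poly_Mapping.keys \<alpha> \<subseteq> {..<m}"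
    using assms by (auto simp: polys_in_def)
  show ?case
  proof (induction F rule: mpoly_monom_induct)
    case (monom \<gamma> d)
    have "mconst c * mmonom \<alpha> * (mconst d * mmonom \<gamma>) = mconst (c * d) * mmonom (\<alpha> + \<gamma>)"
      by (simp add: mmonom_add mconst.hom_mult mult_ac)
    then show ?case
      by (simp only: yapply_mconst_mmonom xpart_add_left[OF \<alpha>] ypart_add_left[OF \<alpha>])
        (simp add: mmonom_add mconst.hom_mult mult_ac)
  qed (simp_all add: yapply.zero yapply.add distrib_left)
qed (simp_all add: yapply.zero yapply.add distrib_right)

lemma yapply_to_y_mult:
  assumes "q \<in> polys_in m"
  shows "yapply m t (to_y m q * F) = yapply m (\<lambda>\<beta>. functional t (q * mmonom \<beta>)) F"
proof (induction F rule: mpoly_monom_induct)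
  case (monom \<gamma> d)
  show ?case
  proof (induction q rule: mpoly_monom_induct)
    case (monom \<alpha> c)
    then have \<alpha>: "Poly_Mapping.keys \<alpha> \<subseteq> {..<m}"
      using assms by (auto simp: polys_in_def)
    have "to_y m (mconst c * mmonom \<alpha>) * (mconst d * mmonom \<gamma>) =
        mconst (c * d) * mmonom (yshift m \<alpha> + \<gamma>)"
      by (simp add: to_y.hom_mult to_y_mconst to_y_mmonom mmonom_add mconst.hom_mult mult_ac)
    moreover have "functional t (mconst c * mmonom \<alpha> * mmonom \<beta>) = c * t (\<alpha> + \<beta>)" for \<beta>
      by (simp add: mult.assoc functional_mconst_mmonom flip: mmonom_add)
    ultimately show ?case
      by (simp only: yapply_mconst_mmonom xpart_add_yshift ypart_add_yshift[OF \<alpha>])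
        (simp add: mult_ac)
  qed (simp_all add: yapply_mconst_mmonom yapply.zero yapply.add functional.zero functional.add
      to_y.hom_add mconst.hom_add distrib_right distrib_left)
qed (simp_all add: yapply.zero yapply.add distrib_left)

lemma yapply_to_y: "q \<in> polys_in m \<Longrightarrow> yapply m t (to_y m q) = mconst (functional t q)"
  using yapply_to_y_mult[of q m t 1] by (simp add: yapply_1)

text \<open>
  If \<open>t\<close> kills the ideal generated by \<open>Q\<close>, then applying it in \<open>y\<close> induces a map
  \<open>K[x,y] / (P(x), Q(y)) \<rightarrow> K[x] / (P)\<close>.
\<close>

lemma yapply_in_ideal_span:
  assumes "P \<subseteq> polys_in m" "Q \<subseteq> polys_in m"
    and kills: "\<And>q p. q \<in> Q \<Longrightarrow> functional t (q * p) = 0"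
    and F: "F \<in> ideal.span (P \<union> to_y m ` Q)"
  shows "yapply m t F \<in> ideal.span P"
  using F
proof (induction rule: ideal.span_induct_alt)
  case base
  show ?case
    by (simp add: yapply.zero ideal.span_zero)
next
  case (step c x y)
  have "yapply m t (c * x) \<in> ideal.span P"
  proof (cases "x \<in> P")
    case True
    then have "yapply m t (c * x) = yapply m t c * x"
      using yapply_x_mult[of x m t c] assms(1) by (auto simp: mult.commute)
    then show ?thesis
      using True by (simp add: ideal.span_scale ideal.span_base)
  next
    case False
    then obtain q where "q \<in> Q" "x = to_y m q"
      using step by blast
    then have "yapply m t (c * x) = 0"
      using yapply_to_y_mult[of q m t c] assms(2) kills
      by (auto simp: mult.commute[of c] yapply_eq_0)
    then show ?thesis
      by (simp add: ideal.span_zero)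
  qed
  then show ?case
    using step by (simp add: yapply.add ideal.span_add)
qed

lemma polys_in_double_eq_sum_mult_to_y:
  fixes F :: "'a::comm_ring_1 mpoly"
  assumes F: "F \<in> polys_in (2 * m)"
  obtains a b and n :: nat where "\<And>i. a i \<in> polys_in m" "\<And>i. b i \<in> polys_in m"
    "F = (\<Sum>i<n. a i * to_y m (b i))"
proof -
  obtain e where e: "bij_betw e {..<card (Poly_Mapping.keys F)} (Poly_Mapping.keys F)"
    using ex_bij_betw_nat_finite[OF finite_keys[of F]] by (auto simp: atLeast0LessThan)
  define a where "a i = mconst (Poly_Mapping.lookup F (e i)) * mmonom (xpart m (e i))" for i
  define b :: "nat \<Rightarrow> 'a mpoly" where "b i = mmonom (ypart m (e i))" for i
  have monom: "(mmonom \<gamma> :: 'a mpoly) = mmonom (xpart m \<gamma>) * to_y m (mmonom (ypart m \<gamma>))"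
    if "\<gamma> \<in> Poly_Mapping.keys F" for \<gamma>
    using that F xpart_plus_yshift_ypart[of \<gamma> m]
    by (auto simp: polys_in_def to_y_mmonom simp flip: mmonom_add)
  have "F = (\<Sum>\<gamma>\<in>Poly_Mapping.keys F. mconst (Poly_Mapping.lookup F \<gamma>) * mmonom \<gamma>)"
    by (rule mpoly_eq_sum_mmonom)
  also have "\<dots> = (\<Sum>i<card (Poly_Mapping.keys F). mconst (Poly_Mapping.lookup F (e i)) * mmonom (e i))"
    by (rule sum.reindex_bij_betw[OF e, symmetric])
  also have "\<dots> = (\<Sum>i<card (Poly_Mapping.keys F). a i * to_y m (b i))"
  proof (rule sum.cong[OF refl])
    fix i assume "i \<in> {..<card (Poly_Mapping.keys F)}"
    then have "e i \<in> Poly_Mapping.keys F"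
      using bij_betwE[OF e] by blast
    then show "mconst (Poly_Mapping.lookup F (e i)) * mmonom (e i) = a i * to_y m (b i)"
      using monom by (simp add: a_def b_def mult.assoc)
  qed
  finally show ?thesis
    by (intro that[of a b]) (auto simp: a_def b_def intro!: polys_in_intros keys_xpart keys_ypart)
qed

lemma yapply_eq_sum_coeffs:
  assumes F: "F \<in> polys_in (2 * m)" and fin: "finite E" "finite E'"
    and E: "\<And>\<alpha>. \<alpha> \<in> E \<Longrightarrow> Poly_Mapping.keys \<alpha> \<subseteq> {..<m}"
    and E': "\<And>\<beta>. \<beta> \<in> E' \<Longrightarrow> Poly_Mapping.keys \<beta> \<subseteq> {..<m}"
    and supp: "\<And>\<alpha> \<beta>. Poly_Mapping.keys \<alpha> \<subseteq> {..<m} \<Longrightarrow> Poly_Mapping.keys \<beta> \<subseteq> {..<m} \<Longrightarrow>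
      Poly_Mapping.lookup F (\<alpha> + yshift m \<beta>) \<noteq> 0 \<Longrightarrow> \<alpha> \<in> E \<and> \<beta> \<in> E'"
  shows "yapply m t F =
    (\<Sum>\<alpha>\<in>E. \<Sum>\<beta>\<in>E'. mconst (Poly_Mapping.lookup F (\<alpha> + yshift m \<beta>) * t \<beta>) * mmonom \<alpha>)"
proof -
  let ?h = "\<lambda>(\<alpha>, \<beta>). \<alpha> + yshift m \<beta>"
  have parts: "xpart m (\<alpha> + yshift m \<beta>) = \<alpha>" "ypart m (\<alpha> + yshift m \<beta>) = \<beta>"
    if "\<alpha> \<in> E" "\<beta> \<in> E'" for \<alpha> \<beta>
    using E[OF that(1)] E'[OF that(2)] xpart_add_yshift[of m \<beta> 0] ypart_add_yshift[of \<beta> m 0]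
    by (simp_all add: xpart_add_left ypart_add_left)
  have inj: "inj_on ?h (E \<times> E')"
    by (rule inj_on_inverseI[of _ "\<lambda>\<gamma>. (xpart m \<gamma>, ypart m \<gamma>)"]) (auto simp: parts)
  have keys: "Poly_Mapping.keys F \<subseteq> ?h ` (E \<times> E')"
  proof
    fix \<gamma> assume \<gamma>: "\<gamma> \<in> Poly_Mapping.keys F"
    then have "Poly_Mapping.keys \<gamma> \<subseteq> {..<2 * m}"
      using F by (auto simp: polys_in_def)
    then have split: "\<gamma> = xpart m \<gamma> + yshift m (ypart m \<gamma>)"
      by (simp add: xpart_plus_yshift_ypart)
    then have "xpart m \<gamma> \<in> E \<and> ypart m \<gamma> \<in> E'"
      using \<gamma> by (intro supp keys_xpart keys_ypart) (simp add: in_keys_iff)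
    then show "\<gamma> \<in> ?h ` (E \<times> E')"
      using split by (intro image_eqI[of _ _ "(xpart m \<gamma>, ypart m \<gamma>)"]) auto
  qed
  have "yapply m t F = (\<Sum>\<gamma>\<in>?h ` (E \<times> E').
      mconst (Poly_Mapping.lookup F \<gamma>) * (mconst (t (ypart m \<gamma>)) * mmonom (xpart m \<gamma>)))"
    unfolding yapply_def by (rule lin_ext_superset) (use fin keys in auto)
  also have "\<dots> = (\<Sum>(\<alpha>, \<beta>)\<in>E \<times> E'. mconst (Poly_Mapping.lookup F (\<alpha> + yshift m \<beta>) * t \<beta>) * mmonom \<alpha>)"
    unfolding sum.reindex[OF inj]
    by (rule sum.cong) (auto simp: parts mconst.hom_mult mult.assoc)
  finally show ?thesis
    by (simp add: sum.cartesian_product)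
qed

subsection \<open>Divided differences\<close>

definition xy_diff :: "nat \<Rightarrow> nat \<Rightarrow> 'a::comm_ring_1 mpoly" where
  "xy_diff m l = mvar l - mvar (m + l)"

lemma mvar_eq_iff: "(mvar k :: 'a::{comm_ring_1, zero_neq_one} mpoly) = mvar l \<longleftrightarrow> k = l"
proof
  assume "mvar k = (mvar l :: 'a mpoly)"
  then have "Poly_Mapping.keys (mvar k :: 'a mpoly) = Poly_Mapping.keys (mvar l :: 'a mpoly)"
    by (rule arg_cong)
  then have "Poly_Mapping.keys (Poly_Mapping.single k (1::nat)) =
      Poly_Mapping.keys (Poly_Mapping.single l (1::nat))"
    by (simp add: mvar_def del: keys_single) simp
  then show "k = l"
    by simp
qed simp

lemma xy_diff_neq_0: "l < m \<Longrightarrow> xy_diff m l \<noteq> (0 :: 'a::idom mpoly)"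
  by (simp add: xy_diff_def mvar_eq_iff)

lemma regular_seq_xy_diff: "regular_seq m (xy_diff m :: nat \<Rightarrow> 'a::idom mpoly)"
  unfolding regular_seq_def
proof (intro allI impI)
  fix k and r :: "'a mpoly"
  let ?I = "ideal.span (xy_diff m ` {..<k})"
  assume k: "k < m" and r: "r * xy_diff m k \<in> ?I"
  define \<theta> :: "nat \<Rightarrow> 'a mpoly" where
    "\<theta> i = (if m \<le> i \<and> i < m + k then mvar (i - m) else mvar i)" for i
  have "mvar i - \<theta> i \<in> ?I" for i
  proof (cases "m \<le> i \<and> i < m + k")
    case True
    then have "mvar i - \<theta> i = - xy_diff m (i - m)"
      by (simp add: \<theta>_def xy_diff_def)
    also have "\<dots> \<in> ?I"
      using True by (intro ideal.span_neg ideal.span_base) auto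
    finally show ?thesis .
  next
    case False
    then show ?thesis
      unfolding \<theta>_def by (simp only: if_False diff_self ideal.span_zero)
  qed
  then have collapse: "p - msubst \<theta> p \<in> ?I" for p
    using msubst_diff_in_ideal[OF ideal.subspace_span, of mvar \<theta>] by (simp add: msubst_mvar_id)
  have "msubst \<theta> (xy_diff m l) = 0" if "l < k" for l
    using that k by (simp add: \<theta>_def xy_diff_def msubst.hom_minus)
  moreover obtain c where "r * xy_diff m k = (\<Sum>l<k. c l * xy_diff m l)"
    using r ideal_span_image_iff[OF finite_lessThan] by blast
  ultimately have "msubst \<theta> (r * xy_diff m k) = 0"
    by (simp add: msubst.hom_sum msubst.hom_mult)
  then have "msubst \<theta> r * xy_diff m k = 0"
    using k by (simp add: \<theta>_def xy_diff_def msubst.hom_minus msubst.hom_mult)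
  then have "msubst \<theta> r = 0"
    using xy_diff_neq_0[OF k, where 'a = 'a] by simp
  then show "r \<in> ?I"
    using collapse[of r] by simp
qed

lemma diag_msubst_Xsubst: "p \<in> polys_in m \<Longrightarrow> diag m (msubst (Xsubst m i) p) = p"
  unfolding diag_def msubst_msubst
  by (subst msubst_cong[of p m _ mvar]) (simp_all add: Xsubst_def msubst_mvar_id)

definition is_divdiff :: "nat \<Rightarrow> nat \<Rightarrow> 'a::comm_ring_1 mpoly \<Rightarrow> 'a mpoly \<Rightarrow> bool" where
  "is_divdiff m l p q \<longleftrightarrow> q \<in> polys_in (2 * m) \<and>
     q * xy_diff m l = msubst (Xsubst m l) p - msubst (Xsubst m (Suc l)) p \<and> diag m q = mpderiv l p"

lemma is_divdiff_mconst: "is_divdiff m l (mconst c) 0"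
  by (simp add: is_divdiff_def polys_in_0 mpderiv_mconst)

lemma is_divdiff_mvar: "is_divdiff m l (mvar k) (if k = l then 1 else 0)"
  by (auto simp: is_divdiff_def polys_in_0 polys_in_1 mpderiv_mvar Xsubst_def xy_diff_def)

lemma is_divdiff_add:
  "is_divdiff m l p q \<Longrightarrow> is_divdiff m l p' q' \<Longrightarrow> is_divdiff m l (p + p') (q + q')"
  by (simp add: is_divdiff_def polys_in_add distrib_right msubst.hom_add diag.hom_add mpderiv_add)

lemma is_divdiff_mult:
  assumes p: "p \<in> polys_in m" and p': "p' \<in> polys_in m"
    and q: "is_divdiff m l p q" and q': "is_divdiff m l p' q'" and "l < m"
  shows "is_divdiff m l (p * p') (q * msubst (Xsubst m l) p' + msubst (Xsubst m (Suc l)) p * q')"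
    (is "is_divdiff m l _ ?r")
proof -
  have "?r * xy_diff m l =
      (q * xy_diff m l) * msubst (Xsubst m l) p' + msubst (Xsubst m (Suc l)) p * (q' * xy_diff m l)"
    by (simp add: algebra_simps)
  also have "\<dots> = msubst (Xsubst m l) (p * p') - msubst (Xsubst m (Suc l)) (p * p')"
    using q q' by (simp only: is_divdiff_def msubst.hom_mult) (simp add: algebra_simps)
  finally have "?r * xy_diff m l = msubst (Xsubst m l) (p * p') - msubst (Xsubst m (Suc l)) (p * p')" .
  moreover have "diag m ?r = mpderiv l (p * p')"
    using q q' p p'
    by (simp add: is_divdiff_def diag.hom_add diag.hom_mult diag_msubst_Xsubst mpderiv_mult)
  moreover have "?r \<in> polys_in (2 * m)"
    using q q' p p' unfolding is_divdiff_def
    by (intro polys_in_add polys_in_mult polys_in_msubst[of _ m])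
      (auto simp: Xsubst_def polys_in_mvar)
  ultimately show ?thesis
    by (simp add: is_divdiff_def)
qed

lemma is_divdiff_exists:
  assumes "p \<in> polys_in m" "l < m"
  shows "\<exists>q. is_divdiff m l p q"
  using assms(1)
proof (induction rule: polys_in_induct)
  case (mult p p')
  then show ?case
    using is_divdiff_mult \<open>l < m\<close> by blast
qed (use is_divdiff_mconst is_divdiff_mvar is_divdiff_add in blast)+

lemma divdiff_eqI:
  fixes p :: "'a::idom mpoly"
  assumes "l < m" "q * xy_diff m l = msubst (Xsubst m l) p - msubst (Xsubst m (Suc l)) p"
  shows "divdiff m (Suc l) p = q"
  unfolding divdiff_def
proof (rule the_equality)
  fix q' assume "q' * (mvar (Suc l - 1) - mvar (m + Suc l - 1)) =
    msubst (Xsubst m (Suc l - 1)) p - msubst (Xsubst m (Suc l)) p"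
  then have "q' * xy_diff m l = q * xy_diff m l"
    using assms(2) by (simp add: xy_diff_def)
  then show "q' = q"
    using xy_diff_neq_0[OF assms(1), where 'a = 'a] by simp
qed (use assms(2) in \<open>simp add: xy_diff_def\<close>)

lemma
  fixes p :: "'a::idom mpoly"
  assumes "p \<in> polys_in m" "l < m"
  shows polys_in_divdiff: "divdiff m (Suc l) p \<in> polys_in (2 * m)"
    and divdiff_mult_xy_diff:
      "divdiff m (Suc l) p * xy_diff m l = msubst (Xsubst m l) p - msubst (Xsubst m (Suc l)) p"
    and diag_divdiff: "diag m (divdiff m (Suc l) p) = mpderiv l p"
proof -
  obtain q where q: "is_divdiff m l p q"
    using is_divdiff_exists[OF assms] by blast
  then have "divdiff m (Suc l) p = q"
    using assms(2) by (intro divdiff_eqI) (auto simp: is_divdiff_def)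
  then show "divdiff m (Suc l) p \<in> polys_in (2 * m)"
    "divdiff m (Suc l) p * xy_diff m l = msubst (Xsubst m l) p - msubst (Xsubst m (Suc l)) p"
    "diag m (divdiff m (Suc l) p) = mpderiv l p"
    using q by (simp_all add: is_divdiff_def)
qed

lemma divdiff_1: "l < m \<Longrightarrow> divdiff m (Suc l) (1 :: 'a::idom mpoly) = 0"
  by (rule divdiff_eqI) auto

lemma sum_divdiff_mult_xy_diff:
  fixes p :: "'a::idom mpoly"
  assumes "p \<in> polys_in m"
  shows "(\<Sum>l<m. divdiff m (Suc l) p * xy_diff m l) = p - to_y m p"
proof -
  have "(\<Sum>l<m. divdiff m (Suc l) p * xy_diff m l) =
      (\<Sum>l<m. msubst (Xsubst m l) p - msubst (Xsubst m (Suc l)) p)"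
    by (simp add: divdiff_mult_xy_diff[OF assms])
  also have "\<dots> = msubst (Xsubst m 0) p - msubst (Xsubst m m) p"
    by (rule sum_lessThan_telescope')
  also have "msubst (Xsubst m 0) p = p"
    using msubst_cong[OF assms, of "Xsubst m 0" mvar] by (simp add: Xsubst_def msubst_mvar_id)
  also have "msubst (Xsubst m m) p = to_y m p"
    unfolding to_y_def by (rule msubst_cong[OF assms]) (simp add: Xsubst_def)
  finally show ?thesis .
qed

subsection \<open>The Bezoutian\<close>

definition bez_delta :: "nat \<Rightarrow> (nat \<Rightarrow> 'a::comm_ring_1 mpoly) \<Rightarrow> 'a mpoly" where
  "bez_delta m f = det (mat m m (\<lambda>(i, j). divdiff m (Suc j) (f i)))"

definition bezoutian_matrix :: "nat \<Rightarrow> (nat \<Rightarrow> 'a::comm_ring_1 mpoly) \<Rightarrow> 'a mpoly \<Rightarrow> 'a mpoly mat" where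
  "bezoutian_matrix m fs f0 = mat (Suc m) (Suc m) (\<lambda>(i, j).
     let fi = if i = 0 then f0 else fs i in if j = 0 then fi else divdiff m j fi)"

lemma bezoutian_matrix_carrier: "bezoutian_matrix m fs f0 \<in> carrier_mat (Suc m) (Suc m)"
  by (simp add: bezoutian_matrix_def)

lemma bezoutian_eq_det: "bezoutian m fs f0 = det (bezoutian_matrix m fs f0)"
  unfolding bezoutian_def bezoutian_matrix_def
  by (simp add: det_on_lessThan atLeast0AtMost flip: lessThan_Suc_atMost)

lemma cofactor_bezoutian_matrix: "cofactor (bezoutian_matrix m fs f0) 0 0 = bez_delta m (fs \<circ> Suc)"
proof -
  have "mat_delete (bezoutian_matrix m fs f0) 0 0 = mat m m (\<lambda>(i, j). divdiff m (Suc j) (fs (Suc i)))"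
    by (rule eq_matI) (auto simp: mat_delete_def bezoutian_matrix_def)
  then show ?thesis
    by (simp add: cofactor_def bez_delta_def)
qed

lemma jacobian_eq_det: "jacobian m fs = det (mat m m (\<lambda>(i, j). mpderiv j (fs (Suc i))))"
proof -
  have "jacobian m fs = det_on (Suc ` {..<m}) (\<lambda>i j. mpderiv (j - 1) (fs i))"
    by (simp add: jacobian_def image_Suc_lessThan)
  also have "\<dots> = det_on {..<m} (\<lambda>i j. mpderiv j (fs (Suc i)))"
    by (subst det_on_image) simp_all
  finally show ?thesis
    by (simp add: det_on_lessThan)
qed

context
  fixes m :: nat and f :: "nat \<Rightarrow> 'a::idom mpoly"
  assumes f_in: "\<And>i. i < m \<Longrightarrow> f i \<in> polys_in m"
begin

lemma polys_in_bez_delta: "bez_delta m f \<in> polys_in (2 * m)"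
  unfolding bez_delta_def
  by (rule polys_in_det) (auto simp: polys_in_divdiff f_in)

lemma diag_bez_delta: "diag m (bez_delta m f) = det (mat m m (\<lambda>(i, j). mpderiv j (f i)))"
proof -
  have "map_mat (diag m) (mat m m (\<lambda>(i, j). divdiff m (Suc j) (f i))) =
      mat m m (\<lambda>(i, j). mpderiv j (f i))"
    by (rule eq_matI) (auto simp: diag_divdiff f_in)
  then show ?thesis
    unfolding bez_delta_def by (metis diag.hom_det)
qed

end

context
  fixes m :: nat and fs :: "nat \<Rightarrow> 'a::idom mpoly" and f0 :: "'a mpoly"
  assumes fs_in: "\<forall>i\<in>{1..m}. fs i \<in> polys_in m"
begin

lemma diag_bez_delta_eq_jacobian: "diag m (bez_delta m (fs \<circ> Suc)) = jacobian m fs"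
  using diag_bez_delta[of m "fs \<circ> Suc"] fs_in by (simp add: jacobian_eq_det)

lemma polys_in_jacobian: "jacobian m fs \<in> polys_in m"
  unfolding jacobian_eq_det by (rule polys_in_det) (auto simp: polys_in_mpderiv fs_in)

lemma bezoutian_1: "bezoutian m fs 1 = bez_delta m (fs \<circ> Suc)"
proof -
  let ?N = "bezoutian_matrix m fs 1"
  have "bezoutian m fs 1 = (\<Sum>j<Suc m. ?N $$ (0, j) * cofactor ?N 0 j)"
    unfolding bezoutian_eq_det by (rule laplace_expansion_row[OF bezoutian_matrix_carrier]) simp
  also have "\<dots> = cofactor ?N 0 0"
    by (subst sum.lessThan_Suc_shift) (simp add: bezoutian_matrix_def divdiff_1)
  finally show ?thesis
    by (simp add: cofactor_bezoutian_matrix)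
qed

context
  assumes f0_in: "f0 \<in> polys_in m"
begin

lemma polys_in_bezoutian: "bezoutian m fs f0 \<in> polys_in (2 * m)"
  unfolding bezoutian_eq_det
proof (rule polys_in_det[OF bezoutian_matrix_carrier])
  fix i j assume i: "i < Suc m" and j: "j < Suc m"
  let ?fi = "if i = 0 then f0 else fs i"
  have "?fi \<in> polys_in m"
    using f0_in fs_in i by auto
  then show "bezoutian_matrix m fs f0 $$ (i, j) \<in> polys_in (2 * m)"
    using i j polys_in_divdiff[of ?fi m "j - 1"] polys_in_mono[of m "2 * m" ?fi]
    by (cases j) (auto simp: bezoutian_matrix_def)
qed

text \<open>
  Cramer's rule, used for \<open>v = (1, 0, \<dots>, 0)\<close>, which the Bezoutian matrix maps to the values of the
  \<open>f\<^sub>i\<close> at \<open>x\<close>, and for \<open>v = (1, y\<^sub>1 - x\<^sub>1, \<dots>, y\<^sub>m - x\<^sub>m)\<close>, which it maps to their values at \<open>y\<close>.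
\<close>

lemma bezoutian_diff_in_ideal_span:
  assumes "v 0 = 1"
    and h: "\<And>i. i < Suc m \<Longrightarrow> (\<Sum>j<Suc m. bezoutian_matrix m fs f0 $$ (i, j) * v j) = h i"
  shows "bezoutian m fs f0 - h 0 * bez_delta m (fs \<circ> Suc) \<in> ideal.span ((h \<circ> Suc) ` {..<m})"
proof -
  let ?N = "bezoutian_matrix m fs f0"
  have "bezoutian m fs f0 = (\<Sum>i<Suc m. cofactor ?N i 0 * (\<Sum>j<Suc m. ?N $$ (i, j) * v j))"
    using cramer_cofactor[OF bezoutian_matrix_carrier, of 0 m fs f0 v] assms(1)
    by (simp add: bezoutian_eq_det)
  also have "\<dots> = (\<Sum>i<Suc m. cofactor ?N i 0 * h i)"
    by (rule sum.cong) (use h in auto)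
  also have "\<dots> = h 0 * bez_delta m (fs \<circ> Suc) + (\<Sum>i<m. cofactor ?N (Suc i) 0 * h (Suc i))"
    unfolding sum.lessThan_Suc_shift cofactor_bezoutian_matrix by (simp add: mult.commute)
  finally have "bezoutian m fs f0 - h 0 * bez_delta m (fs \<circ> Suc) =
      (\<Sum>i<m. cofactor ?N (Suc i) 0 * h (Suc i))"
    by simp
  also have "\<dots> \<in> ideal.span ((h \<circ> Suc) ` {..<m})"
    by (intro ideal.span_sum ideal.span_scale ideal.span_base) auto
  finally show ?thesis .
qed

lemma bezoutian_cong_x:
  "bezoutian m fs f0 - f0 * bez_delta m (fs \<circ> Suc) \<in> ideal.span ((fs \<circ> Suc) ` {..<m})"
proof -
  let ?h = "\<lambda>i. if i = 0 then f0 else fs i"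
  have "bezoutian m fs f0 - ?h 0 * bez_delta m (fs \<circ> Suc) \<in> ideal.span ((?h \<circ> Suc) ` {..<m})"
  proof (rule bezoutian_diff_in_ideal_span[where v = "\<lambda>j. if j = 0 then 1 else 0"])
    show "(\<Sum>j<Suc m. bezoutian_matrix m fs f0 $$ (i, j) * (if j = 0 then 1 else 0)) = ?h i"
      if "i < Suc m" for i
      using that by (subst sum.lessThan_Suc_shift) (simp add: bezoutian_matrix_def)
  qed simp
  then show ?thesis
    by (simp add: comp_def)
qed

lemma bezoutian_cong_y:
  "bezoutian m fs f0 - to_y m f0 * bez_delta m (fs \<circ> Suc) \<in> ideal.span (to_y m ` (fs \<circ> Suc) ` {..<m})"
proof -
  let ?F = "\<lambda>i. if i = 0 then f0 else fs i" and ?v = "\<lambda>j. if j = 0 then 1 else - xy_diff m (j - 1)"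
  let ?h = "\<lambda>i. to_y m (?F i)"
  have "bezoutian m fs f0 - ?h 0 * bez_delta m (fs \<circ> Suc) \<in> ideal.span ((?h \<circ> Suc) ` {..<m})"
  proof (rule bezoutian_diff_in_ideal_span)
    show "(\<Sum>j<Suc m. bezoutian_matrix m fs f0 $$ (i, j) * ?v j) = ?h i" if i: "i < Suc m" for i
    proof -
      have "?F i \<in> polys_in m"
        using i f0_in fs_in by auto
      then have "(\<Sum>l<m. divdiff m (Suc l) (?F i) * xy_diff m l) = ?F i - to_y m (?F i)"
        by (rule sum_divdiff_mult_xy_diff)
      then show ?thesis
        using i by (subst sum.lessThan_Suc_shift) (simp add: bezoutian_matrix_def sum_negf)
    qed
  qed simp
  then show ?thesis
    by (simp add: comp_def image_image)
qed

end

end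

subsection \<open>The transformation law\<close>

lemma sum_divdiff_product_mult_xy_diff:
  fixes p q :: "'a::idom mpoly"
  assumes p: "p \<in> polys_in m" and q: "q \<in> polys_in m"
  shows "(\<Sum>j<m. (to_y m p * divdiff m (Suc j) q + q * divdiff m (Suc j) p) * xy_diff m j) =
    p * q - to_y m (p * q)"
proof -
  have "(\<Sum>j<m. (to_y m p * divdiff m (Suc j) q + q * divdiff m (Suc j) p) * xy_diff m j) =
      to_y m p * (\<Sum>j<m. divdiff m (Suc j) q * xy_diff m j) +
      q * (\<Sum>j<m. divdiff m (Suc j) p * xy_diff m j)"
    by (simp add: sum_distrib_left sum.distrib distrib_right mult.assoc)
  also have "\<dots> = p * q - to_y m (p * q)"
    unfolding sum_divdiff_mult_xy_diff[OF p] sum_divdiff_mult_xy_diff[OF q]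
    by (simp add: to_y.hom_mult algebra_simps)
  finally show ?thesis .
qed

lemma det_diff_bez_delta_in_ideal:
  fixes g :: "nat \<Rightarrow> 'a::idom mpoly"
  assumes I: "ideal.subspace I" and D: "D \<in> carrier_mat m m"
    and g: "\<And>i. i < m \<Longrightarrow> g i \<in> polys_in m"
    and g_I: "\<And>i. i < m \<Longrightarrow> g i \<in> I" "\<And>i. i < m \<Longrightarrow> to_y m (g i) \<in> I"
    and rows: "\<And>i. i < m \<Longrightarrow> (\<Sum>j<m. D $$ (i, j) * xy_diff m j) = g i - to_y m (g i)"
  shows "det D - bez_delta m g \<in> I"
  unfolding bez_delta_def
proof (rule det_diff_in_ideal_of_regular_seq[OF I regular_seq_xy_diff D])
  fix i assume i: "i < m"
  show "(\<Sum>j<m. D $$ (i, j) * xy_diff m j) \<in> I"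
    unfolding rows[OF i] by (rule ideal.subspace_diff[OF I g_I(1)[OF i] g_I(2)[OF i]])
  show "(\<Sum>j<m. D $$ (i, j) * xy_diff m j) =
      (\<Sum>j<m. mat m m (\<lambda>(i, j). divdiff m (Suc j) (g i)) $$ (i, j) * xy_diff m j)"
    using i sum_divdiff_mult_xy_diff[OF g[OF i]] by (simp add: rows[OF i])
qed simp

text \<open>
  The Leibniz rule turns \<open>g = M f\<close> into an expression of \<open>g\<^sub>i(x) - g\<^sub>i(y)\<close> by the \<open>x\<^sub>j - y\<^sub>j\<close> whose
  matrix is \<open>M(y)\<close> times the divided differences of \<open>f\<close>, up to multiples of the \<open>f\<^sub>k(x)\<close>.
\<close>

lemma bez_delta_transformation:
  fixes f :: "nat \<Rightarrow> 'a::idom mpoly"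
  assumes f: "\<And>k. k < m \<Longrightarrow> f k \<in> polys_in m" and M: "M \<in> carrier_mat m m"
    and M_in: "\<And>i k. i < m \<Longrightarrow> k < m \<Longrightarrow> M $$ (i, k) \<in> polys_in m"
    and g: "\<And>i. i < m \<Longrightarrow> g i = (\<Sum>k<m. M $$ (i, k) * f k)"
  shows "to_y m (det M) * bez_delta m f - bez_delta m g \<in> ideal.span (f ` {..<m} \<union> to_y m ` g ` {..<m})"
    (is "_ \<in> ?I")
proof -
  define F where "F = mat m m (\<lambda>(i, j). divdiff m (Suc j) (f i))"
  define D where "D = mat m m (\<lambda>(i, j). \<Sum>k<m.
    to_y m (M $$ (i, k)) * divdiff m (Suc j) (f k) + f k * divdiff m (Suc j) (M $$ (i, k)))"
  have carrier: "F \<in> carrier_mat m m" "D \<in> carrier_mat m m" "map_mat (to_y m) M * F \<in> carrier_mat m m"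
    by (auto simp: F_def D_def M intro!: mult_carrier_mat)
  have "det (map_mat (to_y m) M * F) - det D \<in> ?I"
  proof (rule det_diff_in_ideal[OF ideal.subspace_span carrier(3,2)])
    fix i j assume ij: "i < m" "j < m"
    have "(map_mat (to_y m) M * F) $$ (i, j) = (\<Sum>k<m. to_y m (M $$ (i, k)) * divdiff m (Suc j) (f k))"
      using ij M by (simp add: F_def scalar_prod_def atLeast0LessThan)
    then have "(map_mat (to_y m) M * F) $$ (i, j) - D $$ (i, j) =
        (\<Sum>k<m. - divdiff m (Suc j) (M $$ (i, k)) * f k)"
      using ij by (simp add: D_def sum.distrib sum_negf mult.commute)
    also have "\<dots> \<in> ?I"
      by (intro ideal.span_sum ideal.span_scale ideal.span_base) auto
    finally show "(map_mat (to_y m) M * F) $$ (i, j) - D $$ (i, j) \<in> ?I" .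
  qed
  moreover have "det D - bez_delta m g \<in> ?I"
  proof (rule det_diff_bez_delta_in_ideal[OF ideal.subspace_span carrier(2)])
    fix i assume i: "i < m"
    show "g i \<in> polys_in m" "g i \<in> ?I" "to_y m (g i) \<in> ?I"
      using i
      by (auto simp: g intro!: polys_in_sum polys_in_mult f M_in ideal.span_sum ideal.span_scale
          intro: ideal.span_base)
    have "(\<Sum>j<m. D $$ (i, j) * xy_diff m j) = (\<Sum>k<m. \<Sum>j<m.
        (to_y m (M $$ (i, k)) * divdiff m (Suc j) (f k) + f k * divdiff m (Suc j) (M $$ (i, k))) *
        xy_diff m j)"
      using i by (subst sum.swap, intro sum.cong refl) (simp add: D_def flip: sum_distrib_right)
    then show "(\<Sum>j<m. D $$ (i, j) * xy_diff m j) = g i - to_y m (g i)"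
      using i by (simp add: sum_divdiff_product_mult_xy_diff f M_in g sum_subtractf to_y.hom_sum)
  qed
  moreover have "det (map_mat (to_y m) M * F) = to_y m (det M) * bez_delta m f"
    using det_mult[of "map_mat (to_y m) M" m F] M carrier(1)
    by (simp only: map_carrier_mat to_y.hom_det F_def bez_delta_def)
  ultimately show ?thesis
    using ideal.span_add[of "det (map_mat (to_y m) M * F) - det D" _ "det D - bez_delta m g"]
    by simp
qed

subsection \<open>Univariate systems\<close>

definition poly_in_var :: "nat \<Rightarrow> 'a::comm_ring_1 poly \<Rightarrow> 'a mpoly" where
  "poly_in_var k g = poly (map_poly mconst g) (mvar k)"

lemma poly_map_poly_mconst: "poly (map_poly mconst g) x = (\<Sum>i\<le>degree g. mconst (coeff g i) * x ^ i)"
  using eval_poly_as_sum[of mconst g x] by (simp add: eval_poly_def mult.commute)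

lemma polys_in_poly_in_var: "k < m \<Longrightarrow> poly_in_var k g \<in> polys_in m"
  unfolding poly_in_var_def poly_map_poly_mconst by (intro polys_in_intros)

lemma msubst_poly_in_var: "msubst \<sigma> (poly_in_var k g) = poly (map_poly mconst g) (\<sigma> k)"
  by (simp add: poly_in_var_def poly_map_poly_mconst msubst.hom_sum msubst.hom_mult msubst.hom_power)

lemma poly_synthetic_div_mult_diff:
  fixes p :: "'a::comm_ring_1 poly"
  shows "poly (synthetic_div p c) x * (c - x) = poly p c - poly p x"
proof -
  have "poly p x = (x - c) * poly (synthetic_div p c) x + poly p c"
    by (subst synthetic_div_correct'[of c p, symmetric]) (simp add: algebra_simps)
  then show ?thesis
    by (simp add: algebra_simps)
qed

lemma lead_coeff_synthetic_div:
  assumes "degree p > 0"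
  shows "lead_coeff (synthetic_div p c) = lead_coeff p"
proof -
  obtain d where d: "degree p = Suc d"
    using assms gr0_implies_Suc by blast
  then have "coeff p (Suc d) + c * coeff (synthetic_div p c) (Suc d) = coeff (synthetic_div p c) d"
    using arg_cong[OF synthetic_div_correct[of p c], of "\<lambda>q. coeff q (Suc d)"] by simp
  then show ?thesis
    using d by (simp add: degree_synthetic_div coeff_eq_0)
qed

lemma divdiff_poly_in_var:
  fixes g :: "'a::idom poly"
  assumes "l < m" "k < m"
  shows "divdiff m (Suc l) (poly_in_var k g) =
    (if l = k then poly (synthetic_div (map_poly mconst g) (mvar k)) (mvar (m + k)) else 0)"
  by (rule divdiff_eqI[OF assms(1)])
    (auto simp: msubst_poly_in_var Xsubst_def xy_diff_def poly_synthetic_div_mult_diff)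

lemma bez_delta_univariate:
  fixes g :: "nat \<Rightarrow> 'a::idom poly"
  shows "bez_delta m (\<lambda>k. poly_in_var k (g k)) =
    (\<Prod>k<m. poly (synthetic_div (map_poly mconst (g k)) (mvar k)) (mvar (m + k)))"
proof -
  let ?D = "mat m m (\<lambda>(i, j). divdiff m (Suc j) (poly_in_var i (g i)))"
  have "upper_triangular ?D"
    by (auto simp: divdiff_poly_in_var)
  then have "det ?D = prod_list (diag_mat ?D)"
    by (rule det_upper_triangular[where n = m]) simp
  then show ?thesis
    by (simp add: bez_delta_def prod_list_diag_prod atLeast0LessThan divdiff_poly_in_var)
qed

lemma polys_in_coeff_synthetic_div:
  fixes c :: "'a::comm_ring_1 mpoly"
  assumes "\<And>i. coeff p i \<in> polys_in m" and c: "c \<in> polys_in m"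
  shows "coeff (synthetic_div p c) i \<in> polys_in m"
  using assms(1)
proof (induction p arbitrary: i)
  case (pCons a p)
  have "coeff p i \<in> polys_in m" for i
    using pCons.prems[of "Suc i"] by simp
  then show ?case
    using pCons.IH c
    by (auto simp: coeff_pCons poly_altdef split: nat.split intro!: polys_in_intros)
qed (simp add: polys_in_0)

definition prod_functional :: "nat \<Rightarrow> (nat \<Rightarrow> nat \<Rightarrow> 'a::comm_ring_1) \<Rightarrow> (nat \<Rightarrow>\<^sub>0 nat) \<Rightarrow> 'a" where
  "prod_functional m \<tau> \<beta> = (\<Prod>j<m. \<tau> j (Poly_Mapping.lookup \<beta> j))"

lemma functional_prod_functional_prod_mvar:
  "functional (prod_functional m \<tau>) (\<Prod>j<m. mvar j ^ e j) = (\<Prod>j<m. \<tau> j (e j))"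
proof -
  have "Poly_Mapping.lookup (\<Sum>j<m. Poly_Mapping.single j (e j)) i = e i" if "i < m" for i
    using that by (simp add: lookup_sum lookup_single when_def)
  then show ?thesis
    by (simp add: mvar_power functional_mmonom prod_functional_def flip: mmonom_sum)
qed

lemma yapply_prod_functional_prod_poly:
  fixes q :: "nat \<Rightarrow> 'a::comm_ring_1 mpoly poly"
  assumes q: "\<And>j i. j < m \<Longrightarrow> coeff (q j) i \<in> polys_in m"
  shows "yapply m (prod_functional m \<tau>) (\<Prod>j<m. poly (q j) (mvar (m + j))) =
    (\<Prod>j<m. \<Sum>i\<le>degree (q j). coeff (q j) i * mconst (\<tau> j i))"
proof -
  have monomial: "yapply m (prod_functional m \<tau>) (\<Prod>j<m. coeff (q j) (e j) * mvar (m + j) ^ e j) =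
      (\<Prod>j<m. coeff (q j) (e j) * mconst (\<tau> j (e j)))" for e
  proof -
    have "(\<Prod>j<m. coeff (q j) (e j) * mvar (m + j) ^ e j) =
        (\<Prod>j<m. coeff (q j) (e j)) * to_y m (\<Prod>j<m. mvar j ^ e j)"
      by (simp add: prod.distrib to_y.hom_prod to_y.hom_power to_y_mvar)
    moreover have "(\<Prod>j<m. coeff (q j) (e j)) \<in> polys_in m"
      "(\<Prod>j<m. mvar j ^ e j :: 'a mpoly) \<in> polys_in m"
      by (auto intro!: polys_in_prod polys_in_power polys_in_mvar q)
    ultimately have "yapply m (prod_functional m \<tau>) (\<Prod>j<m. coeff (q j) (e j) * mvar (m + j) ^ e j) =
        (\<Prod>j<m. coeff (q j) (e j)) * mconst (\<Prod>j<m. \<tau> j (e j))"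
      by (simp only: yapply_x_mult yapply_to_y functional_prod_functional_prod_mvar)
    then show ?thesis
      by (simp add: prod.distrib mconst.hom_prod)
  qed
  have "yapply m (prod_functional m \<tau>) (\<Prod>j<m. poly (q j) (mvar (m + j))) =
      yapply m (prod_functional m \<tau>) (\<Sum>e\<in>PiE {..<m} (\<lambda>j. {..degree (q j)}).
        \<Prod>j<m. coeff (q j) (e j) * mvar (m + j) ^ e j)"
    by (simp add: poly_altdef prod_sum_PiE)
  also have "\<dots> = (\<Sum>e\<in>PiE {..<m} (\<lambda>j. {..degree (q j)}). \<Prod>j<m. coeff (q j) (e j) * mconst (\<tau> j (e j)))"
    by (simp only: yapply.sum monomial)
  also have "\<dots> = (\<Prod>j<m. \<Sum>i\<le>degree (q j). coeff (q j) i * mconst (\<tau> j i))"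
    by (rule prod_sum_PiE[symmetric]) simp_all
  finally show ?thesis .
qed

lemma functional_prod_functional_eq_0:
  assumes j: "j < m" and rec: "\<And>k. (\<Sum>i\<le>degree g. coeff g i * \<tau> j (k + i)) = 0"
  shows "functional (prod_functional m \<tau>) (poly_in_var j g * p) = 0"
proof (induction p rule: mpoly_monom_induct)
  case (monom \<beta> c)
  let ?e = "Poly_Mapping.lookup \<beta>"
  let ?R = "\<Prod>l\<in>{..<m} - {j}. \<tau> l (?e l)"
  have shift: "prod_functional m \<tau> (Poly_Mapping.single j i + \<beta>) = \<tau> j (?e j + i) * ?R" for i
  proof -
    have "prod_functional m \<tau> (Poly_Mapping.single j i + \<beta>) =
        (\<Prod>l<m. \<tau> l (if l = j then ?e j + i else ?e l))"
      unfolding prod_functional_def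
      by (rule prod.cong) (auto simp: lookup_add lookup_single when_def add.commute)
    also have "\<dots> = \<tau> j (?e j + i) * ?R"
      using j by (simp add: prod.remove[of "{..<m}" j])
    finally show ?thesis .
  qed
  have "poly_in_var j g * (mconst c * mmonom \<beta>) =
      (\<Sum>i\<le>degree g. mconst (c * coeff g i) * mmonom (Poly_Mapping.single j i + \<beta>))"
    by (simp add: poly_in_var_def poly_map_poly_mconst sum_distrib_left sum_distrib_right mvar_power
        mmonom_add mconst.hom_mult mult_ac)
  then have "functional (prod_functional m \<tau>) (poly_in_var j g * (mconst c * mmonom \<beta>)) =
      c * ?R * (\<Sum>i\<le>degree g. coeff g i * \<tau> j (?e j + i))"
    by (simp add: functional.sum functional_mconst_mmonom shift sum_distrib_left mult_ac)
  then show ?case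
    by (simp add: rec)
qed (simp_all add: functional.zero functional.add distrib_left)

text \<open>
  The residue of a monic polynomial \<open>g\<close> of degree \<open>d\<close> maps \<open>h\<close> to the coefficient of \<open>T\<^sup>d\<^sup>-\<^sup>1\<close> in
  \<open>h mod g\<close>.
\<close>

definition residue_monom :: "'a::field poly \<Rightarrow> nat \<Rightarrow> 'a" where
  "residue_monom g k = coeff (monom 1 k mod g) (degree g - 1)"

lemma residue_monom_less: "k < degree g \<Longrightarrow> residue_monom g k = (if k = degree g - 1 then 1 else 0)"
  by (simp add: residue_monom_def mod_poly_less degree_monom_eq)

lemma residue_monom_recurrence: "(\<Sum>i\<le>degree g. coeff g i * residue_monom g (k + i)) = 0"
proof -
  have mod_sum: "(\<Sum>i\<in>S. h i) mod g = (\<Sum>i\<in>S. h i mod g)" for S :: "nat set" and h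
    by (induction S rule: infinite_finite_induct) (auto simp: poly_mod_add_left)
  have "monom 1 k * g = monom 1 k * (\<Sum>i\<le>degree g. monom (coeff g i) i)"
    by (simp add: poly_as_sum_of_monoms)
  also have "\<dots> = (\<Sum>i\<le>degree g. Polynomial.smult (coeff g i) (monom 1 (k + i)))"
    by (simp add: sum_distrib_left mult_monom smult_monom)
  finally have "(\<Sum>i\<le>degree g. Polynomial.smult (coeff g i) (monom 1 (k + i) mod g)) = 0"
    using mod_mult_self2_is_0[of "monom 1 k" g] by (simp add: mod_sum mod_smult_left)
  from arg_cong[OF this, of "\<lambda>h. coeff h (degree g - 1)"] show ?thesis
    by (simp add: coeff_sum residue_monom_def)
qed

lemma sum_coeff_mult_residue_monom:
  assumes s: "degree s = degree g - 1" "lead_coeff s = 1" and g: "degree g > 0"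
  shows "(\<Sum>i\<le>degree s. coeff s i * mconst (residue_monom g i)) = 1"
proof -
  have "(\<Sum>i\<le>degree s. coeff s i * mconst (residue_monom g i)) =
      (\<Sum>i\<le>degree s. if i = degree s then coeff s i else 0)"
    by (rule sum.cong) (use s g in \<open>auto simp: residue_monom_less\<close>)
  then show ?thesis
    using s by simp
qed

lemma yapply_bez_delta_univariate:
  fixes g :: "nat \<Rightarrow> 'a::field poly"
  assumes monic: "\<And>j. j < m \<Longrightarrow> lead_coeff (g j) = 1" and deg: "\<And>j. j < m \<Longrightarrow> degree (g j) > 0"
  shows "yapply m (prod_functional m (\<lambda>j. residue_monom (g j)))
    (bez_delta m (\<lambda>j. poly_in_var j (g j))) = 1"
proof -
  define s where "s j = synthetic_div (map_poly mconst (g j)) (mvar j)" for j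
  have coeff_g: "coeff (map_poly mconst (g j)) i = mconst (coeff (g j) i)" for i j
    by (simp add: coeff_map_poly)
  have deg_g: "degree (map_poly mconst (g j)) = degree (g j)" if "j < m" for j
    using degree_map_poly[of mconst "g j"] monic[OF that] by (cases "g j = 0") auto
  have s: "degree (s j) = degree (g j) - 1" "lead_coeff (s j) = 1" if "j < m" for j
    using lead_coeff_synthetic_div[of "map_poly mconst (g j)" "mvar j"]
      deg_g[OF that] deg[OF that] monic[OF that]
    by (simp_all add: s_def coeff_g degree_synthetic_div)
  have "(\<Sum>i\<le>degree (s j). coeff (s j) i * mconst (residue_monom (g j) i)) = 1" if "j < m" for j
    by (rule sum_coeff_mult_residue_monom[OF s[OF that] deg[OF that]])
  moreover have "coeff (s j) i \<in> polys_in m" if "j < m" for j i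
    unfolding s_def using that
    by (intro polys_in_coeff_synthetic_div) (auto simp: coeff_g intro: polys_in_intros)
  ultimately show ?thesis
    by (simp add: bez_delta_univariate yapply_prod_functional_prod_poly flip: s_def)
qed

subsection \<open>Finite-dimensional quotients\<close>

lemma in_ideal_span_obtain_polys_in:
  fixes f :: "nat \<Rightarrow> 'a::comm_ring_1 mpoly"
  assumes f: "\<And>i. i < n \<Longrightarrow> f i \<in> polys_in m"
    and p: "p \<in> polys_in m" "p \<in> ideal.span (f ` {..<n})"
  obtains c where "\<And>i. c i \<in> polys_in m" "p = (\<Sum>i<n. c i * f i)"
proof -
  define \<rho> :: "nat \<Rightarrow> 'a mpoly" where "\<rho> k = (if k < m then mvar k else 0)" for k
  have retract: "msubst \<rho> q = q" if "q \<in> polys_in m" for q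
    using msubst_cong[OF that, of \<rho> mvar] by (simp add: \<rho>_def msubst_mvar_id)
  have \<rho>_in: "msubst \<rho> q \<in> polys_in m" for q
    by (induction q rule: mpoly_induct)
      (auto simp: \<rho>_def msubst.hom_add msubst.hom_mult intro: polys_in_intros)
  obtain d where d: "p = (\<Sum>i<n. d i * f i)"
    using p(2) ideal_span_image_iff[OF finite_lessThan] by blast
  have "p = msubst \<rho> (\<Sum>i<n. d i * f i)"
    using retract[OF p(1)] by (simp only: d)
  also have "\<dots> = (\<Sum>i<n. msubst \<rho> (d i) * f i)"
    by (simp add: msubst.hom_sum msubst.hom_mult retract f)
  finally show ?thesis
    by (rule that[OF \<rho>_in])
qed

lemma gen_ideal_eq:
  assumes fs: "\<forall>i\<in>{1..m}. fs i \<in> polys_in m"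
  shows "gen_ideal m fs = ideal.span ((fs \<circ> Suc) ` {..<m}) \<inter> polys_in m"
proof (intro equalityI subsetI)
  have image: "(fs \<circ> Suc) ` {..<m} = fs ` {1..m}"
    by (simp only: image_comp[symmetric] image_Suc_lessThan)
  fix p assume "p \<in> gen_ideal m fs"
  then obtain g where p: "p = (\<Sum>i=1..m. g i * fs i)" and g: "\<And>i. i \<in> {1..m} \<Longrightarrow> g i \<in> polys_in m"
    by (auto simp: gen_ideal_def)
  have "p \<in> ideal.span (fs ` {1..m})"
    unfolding p by (rule sum_in_ideal_span)
  moreover have "p \<in> polys_in m"
    unfolding p by (intro polys_in_sum polys_in_mult g bspec[OF fs])
  ultimately show "p \<in> ideal.span ((fs \<circ> Suc) ` {..<m}) \<inter> polys_in m"
    by (simp only: image Int_iff)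
next
  fix p assume "p \<in> ideal.span ((fs \<circ> Suc) ` {..<m}) \<inter> polys_in m"
  then obtain c where c: "\<And>i. c i \<in> polys_in m" "p = (\<Sum>i<m. c i * (fs \<circ> Suc) i)"
    using in_ideal_span_obtain_polys_in[of m "fs \<circ> Suc" m p] fs by auto
  then have "p = (\<Sum>i=1..m. c (i - 1) * fs i)"
    by (simp add: sum.atLeast1_atMost_eq)
  then show "p \<in> gen_ideal m fs"
    unfolding gen_ideal_def using c(1) by (intro CollectI exI[of _ "\<lambda>i. c (i - 1)"]) auto
qed

lemma poly_char_poly_eq_det:
  fixes x :: "'a::comm_ring_1 mpoly"
  assumes A: "A \<in> carrier_mat n n"
  shows "poly (map_poly mconst (char_poly A)) x =
    det (mat n n (\<lambda>(i, j). (if i = j then x else 0) - mconst (A $$ (i, j))))"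
proof -
  interpret mconst_poly: map_poly_comm_ring_hom "mconst :: 'a \<Rightarrow> 'a mpoly" ..
  interpret eval: comm_ring_hom "\<lambda>p. poly (map_poly mconst p) x"
    by unfold_locales (simp_all add: mconst_poly.hom_add mconst_poly.hom_mult)
  have "map_mat (\<lambda>p. poly (map_poly mconst p) x) (char_poly_matrix A) =
      mat n n (\<lambda>(i, j). (if i = j then x else 0) - mconst (A $$ (i, j)))"
    by (rule eq_matI)
      (use A in \<open>auto simp: char_poly_matrix_def mconst.map_poly_pCons_hom mconst.hom_uminus\<close>)
  then show ?thesis
    using eval.hom_det[of "char_poly_matrix A"] by (simp add: char_poly_def)
qed

text \<open>
  The determinant trick: \<open>x\<close> is a root modulo \<open>I\<close> of the characteristic polynomial of multiplication
  by \<open>x\<close>.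
\<close>

lemma exists_monic_annihilator_in_ideal:
  fixes x :: "'a::comm_ring_1 mpoly"
  assumes I: "ideal.subspace I" and B: "finite B"
    and one: "1 - (\<Sum>b\<in>B. mconst (c b) * b) \<in> I"
    and mult: "\<And>b. b \<in> B \<Longrightarrow> \<exists>c. x * b - (\<Sum>b'\<in>B. mconst (c b') * b') \<in> I"
  obtains g where "lead_coeff g = 1" "poly (map_poly mconst g) x \<in> I"
proof -
  let ?n = "card B"
  obtain e where e: "bij_betw e {..<?n} B"
    using ex_bij_betw_nat_finite[OF B] by (auto simp: atLeast0LessThan)
  have sum_B: "(\<Sum>b\<in>B. h b) = (\<Sum>i<?n. h (e i))" for h :: "_ \<Rightarrow> 'a mpoly"
    by (rule sum.reindex_bij_betw[OF e, symmetric])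
  have "\<forall>b\<in>B. \<exists>c. x * b - (\<Sum>b'\<in>B. mconst (c b') * b') \<in> I"
    using mult by blast
  from bchoice[OF this] obtain C where C: "\<forall>b\<in>B. x * b - (\<Sum>b'\<in>B. mconst (C b b') * b') \<in> I"
    by blast
  define A where "A = mat ?n ?n (\<lambda>(i, j). C (e i) (e j))"
  define N where "N = mat ?n ?n (\<lambda>(i, j). (if i = j then x else 0) - mconst (A $$ (i, j)))"
  have A: "A \<in> carrier_mat ?n ?n" and N: "N \<in> carrier_mat ?n ?n"
    by (simp_all add: A_def N_def)
  have rows: "(\<Sum>j<?n. N $$ (i, j) * e j) \<in> I" if i: "i < ?n" for i
  proof -
    have "(\<Sum>j<?n. N $$ (i, j) * e j) =
        (\<Sum>j<?n. (if i = j then x * e j else 0) - mconst (C (e i) (e j)) * e j)"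
      by (rule sum.cong) (use i in \<open>auto simp: N_def A_def left_diff_distrib\<close>)
    also have "\<dots> = x * e i - (\<Sum>b\<in>B. mconst (C (e i) b) * b)"
      using i by (simp add: sum_subtractf sum_B)
    finally show ?thesis
      using C bij_betwE[OF e] i by simp
  qed
  have "(\<Sum>i<?n. mconst (c (e i)) * (det N * e i)) \<in> I"
    by (rule ideal.subspace_sum[OF I], rule ideal.subspace_scale[OF I])
      (simp add: det_mult_in_ideal[OF I N rows])
  then have "(\<Sum>i<?n. mconst (c (e i)) * (det N * e i)) + det N * (1 - (\<Sum>b\<in>B. mconst (c b) * b)) \<in> I"
    by (rule ideal.subspace_add[OF I _ ideal.subspace_scale[OF I one]])
  moreover have "(\<Sum>i<?n. mconst (c (e i)) * (det N * e i)) = det N * (\<Sum>b\<in>B. mconst (c b) * b)"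
    by (simp add: sum_B sum_distrib_left mult_ac)
  ultimately have "poly (map_poly mconst (char_poly A)) x \<in> I"
    by (simp add: right_diff_distrib poly_char_poly_eq_det[OF A] N_def)
  then show ?thesis
    using that[of "char_poly A"] degree_monic_char_poly[OF A] by simp
qed

lemma fin_dim_quotient_obtain_univariate:
  fixes I :: "'a::comm_ring_1 mpoly set"
  assumes fin: "fin_dim_quotient m I" and "I \<subseteq> J" and J: "ideal.subspace J" and "k < m"
  obtains g where "lead_coeff g = 1" "degree g > 0" "poly_in_var k g \<in> J"
proof -
  obtain B where B: "finite B" "B \<subseteq> polys_in m"
    and "\<forall>p\<in>polys_in m. \<exists>c. p - (\<Sum>b\<in>B. mconst (c b) * b) \<in> I"
    using fin unfolding fin_dim_quotient_def by blast
  then have span: "\<exists>c. p - (\<Sum>b\<in>B. mconst (c b) * b) \<in> J" if "p \<in> polys_in m" for p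
    using that \<open>I \<subseteq> J\<close> by blast
  obtain c where "1 - (\<Sum>b\<in>B. mconst (c b) * b) \<in> J"
    using span[OF polys_in_1] by blast
  moreover have "\<exists>c. mvar k * b - (\<Sum>b'\<in>B. mconst (c b') * b') \<in> J" if "b \<in> B" for b
    using that B \<open>k < m\<close> by (intro span polys_in_mult polys_in_mvar) auto
  ultimately obtain h where h: "lead_coeff h = 1" "poly (map_poly mconst h) (mvar k) \<in> J"
    using exists_monic_annihilator_in_ideal[OF J B(1)] by blast
  then have "h \<noteq> 0"
    by auto
  moreover have "poly_in_var k (pCons 0 h) = mvar k * poly (map_poly mconst h) (mvar k)"
    by (simp add: poly_in_var_def mconst.map_poly_pCons_hom)
  ultimately show ?thesis
    using that[of "pCons 0 h"] h ideal.subspace_scale[OF J] by simp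
qed

subsection \<open>The residue functional\<close>

definition is_residue :: "nat \<Rightarrow> (nat \<Rightarrow> 'a::comm_ring_1 mpoly) \<Rightarrow> ((nat \<Rightarrow>\<^sub>0 nat) \<Rightarrow> 'a) \<Rightarrow> bool" where
  "is_residue m f t \<longleftrightarrow> (\<forall>p\<in>ideal.span (f ` {..<m}). functional t p = 0) \<and>
     yapply m t (bez_delta m f) - 1 \<in> ideal.span (f ` {..<m})"

lemma is_residue_mult_eq_0:
  assumes "is_residue m f t" "q \<in> ideal.span (f ` {..<m})"
  shows "functional t (q * r) = 0"
  using assms ideal.span_scale[OF assms(2), of r] by (simp add: is_residue_def mult.commute)

lemma is_residue_transformation:
  fixes f :: "nat \<Rightarrow> 'a::idom mpoly"
  assumes f: "\<And>k. k < m \<Longrightarrow> f k \<in> polys_in m" and M: "M \<in> carrier_mat m m"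
    and M_in: "\<And>i k. i < m \<Longrightarrow> k < m \<Longrightarrow> M $$ (i, k) \<in> polys_in m"
    and g: "\<And>i. i < m \<Longrightarrow> g i = (\<Sum>k<m. M $$ (i, k) * f k)"
    and res: "is_residue m g \<tau>"
  shows "is_residue m f (\<lambda>\<beta>. functional \<tau> (det M * mmonom \<beta>))"
  unfolding is_residue_def
proof
  show "\<forall>p\<in>ideal.span (f ` {..<m}). functional (\<lambda>\<beta>. functional \<tau> (det M * mmonom \<beta>)) p = 0"
    using res det_mult_in_ideal_span[OF M _ g] by (simp add: is_residue_def flip: functional_mult)
  let ?I = "ideal.span (f ` {..<m})"
  have det_M: "det M \<in> polys_in m"
    by (rule polys_in_det[OF M M_in])
  have g_span: "ideal.span (g ` {..<m}) \<subseteq> ?I"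
    by (rule ideal.span_minimal) (auto simp: g intro!: sum_in_ideal_span)
  have "g i \<in> polys_in m" if "i < m" for i
    unfolding g[OF that] using that by (intro polys_in_sum polys_in_mult f M_in) auto
  then have "yapply m \<tau> (to_y m (det M) * bez_delta m f - bez_delta m g) \<in> ?I"
    using f by (intro yapply_in_ideal_span[OF _ _ _ bez_delta_transformation[OF f M M_in g]]
        is_residue_mult_eq_0[OF res]) (auto intro: ideal.span_base)
  moreover have "yapply m \<tau> (bez_delta m g) - 1 \<in> ?I"
    using res g_span by (auto simp: is_residue_def)
  ultimately have "yapply m \<tau> (to_y m (det M) * bez_delta m f) - 1 \<in> ?I"
    using ideal.span_add by (fastforce simp: yapply.diff)
  then show "yapply m (\<lambda>\<beta>. functional \<tau> (det M * mmonom \<beta>)) (bez_delta m f) - 1 \<in> ?I"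
    by (simp only: yapply_to_y_mult[OF det_M])
qed

lemma functional_eq_0_on_ideal_span:
  assumes "p \<in> ideal.span Q" "\<And>q r. q \<in> Q \<Longrightarrow> functional t (q * r) = 0"
  shows "functional t p = 0"
  using assms(1)
proof (induction rule: ideal.span_induct_alt)
  case (step c x y)
  then show ?case
    using assms(2)[of x c] by (simp add: functional.add mult.commute)
qed (rule functional.zero)

lemma is_residue_univariate:
  fixes g :: "nat \<Rightarrow> 'a::field poly"
  assumes "\<And>j. j < m \<Longrightarrow> lead_coeff (g j) = 1" "\<And>j. j < m \<Longrightarrow> degree (g j) > 0"
  shows "is_residue m (\<lambda>j. poly_in_var j (g j)) (prod_functional m (\<lambda>j. residue_monom (g j)))"
  unfolding is_residue_def
proof
  have "functional (prod_functional m (\<lambda>j. residue_monom (g j))) (poly_in_var j (g j) * r) = 0"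
    if "j < m" for j r
    by (rule functional_prod_functional_eq_0[OF that residue_monom_recurrence])
  then show "\<forall>p\<in>ideal.span ((\<lambda>j. poly_in_var j (g j)) ` {..<m}).
      functional (prod_functional m (\<lambda>j. residue_monom (g j))) p = 0"
    using functional_eq_0_on_ideal_span by blast
qed (use yapply_bez_delta_univariate[OF assms] in \<open>simp add: ideal.span_zero\<close>)

lemma residue_exists:
  fixes f :: "nat \<Rightarrow> 'a::field mpoly"
  assumes f: "\<And>k. k < m \<Longrightarrow> f k \<in> polys_in m"
    and fin: "fin_dim_quotient m (ideal.span (f ` {..<m}) \<inter> polys_in m)"
  obtains t where "is_residue m f t"
proof -
  let ?I = "ideal.span (f ` {..<m})"
  have "\<exists>g. lead_coeff g = 1 \<and> degree g > 0 \<and> poly_in_var j g \<in> ?I" if "j < m" for j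
    using fin_dim_quotient_obtain_univariate[OF fin Int_lower1 ideal.subspace_span that] by blast
  then obtain g where g: "\<And>j. j < m \<Longrightarrow> lead_coeff (g j) = 1" "\<And>j. j < m \<Longrightarrow> degree (g j) > 0"
    "\<And>j. j < m \<Longrightarrow> poly_in_var j (g j) \<in> ?I"
    by metis
  have "\<exists>c. (\<forall>k. c k \<in> polys_in m) \<and> poly_in_var j (g j) = (\<Sum>k<m. c k * f k)" if "j < m" for j
    using in_ideal_span_obtain_polys_in[OF f polys_in_poly_in_var[OF that] g(3)[OF that]] by blast
  then obtain c where c_in: "\<And>j k. j < m \<Longrightarrow> c j k \<in> polys_in m"
    and c: "\<And>j. j < m \<Longrightarrow> poly_in_var j (g j) = (\<Sum>k<m. c j k * f k)"
    by metis
  define M where "M = mat m m (\<lambda>(j, k). c j k)"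
  show ?thesis
  proof (rule that, rule is_residue_transformation[OF f _ _ _ is_residue_univariate[OF g(1,2)]])
    show "M \<in> carrier_mat m m"
      by (simp add: M_def)
    show "M $$ (j, k) \<in> polys_in m" if "j < m" "k < m" for j k
      using that c_in by (simp add: M_def)
    show "poly_in_var j (g j) = (\<Sum>k<m. M $$ (j, k) * f k)" if "j < m" for j
      using that c by (simp add: M_def)
  qed
qed

lemma residue_reproducing:
  fixes fs :: "nat \<Rightarrow> 'a::idom mpoly"
  assumes fs: "\<forall>i\<in>{1..m}. fs i \<in> polys_in m" and res: "is_residue m (fs \<circ> Suc) t"
    and h: "h \<in> polys_in m"
  shows "h - yapply m t (to_y m h * bez_delta m (fs \<circ> Suc)) \<in> gen_ideal m fs"
proof -
  let ?P = "(fs \<circ> Suc) ` {..<m}" and ?\<Delta> = "bez_delta m (fs \<circ> Suc)"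
  let ?I = "ideal.span (?P \<union> to_y m ` ?P)"
  have "bezoutian m fs h - h * ?\<Delta> \<in> ?I"
    using bezoutian_cong_x[OF fs h] ideal.span_mono[of ?P "?P \<union> to_y m ` ?P"] by blast
  moreover have "bezoutian m fs h - to_y m h * ?\<Delta> \<in> ?I"
    using bezoutian_cong_y[OF fs h] ideal.span_mono[of "to_y m ` ?P" "?P \<union> to_y m ` ?P"] by blast
  ultimately have "h * ?\<Delta> - to_y m h * ?\<Delta> \<in> ?I"
    using ideal.span_diff by fastforce
  then have "yapply m t (h * ?\<Delta> - to_y m h * ?\<Delta>) \<in> ideal.span ?P"
    using fs by (intro yapply_in_ideal_span[where Q = ?P] is_residue_mult_eq_0[OF res])
      (auto intro: ideal.span_base)
  moreover have "h * (yapply m t ?\<Delta> - 1) \<in> ideal.span ?P"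
    using res by (intro ideal.span_scale) (simp add: is_residue_def)
  ultimately have "yapply m t (h * ?\<Delta> - to_y m h * ?\<Delta>) - h * (yapply m t ?\<Delta> - 1) \<in> ideal.span ?P"
    by (rule ideal.span_diff)
  then have "h - yapply m t (to_y m h * ?\<Delta>) \<in> ideal.span ?P"
    by (simp add: yapply.diff yapply_x_mult[OF h] algebra_simps)
  then show ?thesis
    by (simp add: gen_ideal_eq[OF fs] polys_in_diff polys_in_yapply h)
qed

lemma in_gen_ideal_iff_functional_eq_0:
  fixes fs :: "nat \<Rightarrow> 'a::idom mpoly"
  assumes fs: "\<forall>i\<in>{1..m}. fs i \<in> polys_in m" and res: "is_residue m (fs \<circ> Suc) t"
    and q: "q \<in> polys_in m"
  shows "q \<in> gen_ideal m fs \<longleftrightarrow> (\<forall>r\<in>polys_in m. functional t (q * r) = 0)"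
proof
  assume "q \<in> gen_ideal m fs"
  then show "\<forall>r\<in>polys_in m. functional t (q * r) = 0"
    using is_residue_mult_eq_0[OF res, of q] by (simp add: gen_ideal_eq[OF fs])
next
  assume "\<forall>r\<in>polys_in m. functional t (q * r) = 0"
  then have "yapply m t (to_y m q * bez_delta m (fs \<circ> Suc)) = 0"
    unfolding yapply_to_y_mult[OF q] by (intro yapply_eq_0) (auto intro: polys_in_mmonom)
  then show "q \<in> gen_ideal m fs"
    using residue_reproducing[OF fs res q] by simp
qed

subsection \<open>Ideal quotients and the radical\<close>

lemma reproducing_form_residue:
  fixes fs :: "nat \<Rightarrow> 'a::{alg_closed_field, field_char_0} mpoly" and n :: nat
  assumes fs: "\<forall>i\<in>{1..m}. fs i \<in> polys_in m" and res: "is_residue m (fs \<circ> Suc) t"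
    and a: "\<And>i. a i \<in> polys_in m" and b: "\<And>i. b i \<in> polys_in m"
    and \<Delta>: "bez_delta m (fs \<circ> Suc) = (\<Sum>i<n. a i * to_y m (b i))"
  shows "reproducing_form (functional t) (polys_in m) n a b"
proof
  fix x y :: "'a mpoly"
  assume x: "x \<in> polys_in m" and y: "y \<in> polys_in m"
  have "to_y m x * bez_delta m (fs \<circ> Suc) = (\<Sum>i<n. a i * to_y m (x * b i))"
    by (simp add: \<Delta> sum_distrib_left to_y.hom_mult mult_ac)
  then have "yapply m t (to_y m x * bez_delta m (fs \<circ> Suc)) =
      (\<Sum>i<n. mconst (functional t (x * b i)) * a i)"
    by (simp add: yapply.sum yapply_x_mult yapply_to_y a b x polys_in_mult mult.commute)
  then have "x - (\<Sum>i<n. mconst (functional t (x * b i)) * a i) \<in> gen_ideal m fs"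
    using residue_reproducing[OF fs res x] by simp
  then have "functional t ((x - (\<Sum>i<n. mconst (functional t (x * b i)) * a i)) * y) = 0"
    by (intro is_residue_mult_eq_0[OF res]) (simp add: gen_ideal_eq[OF fs])
  then show "functional t (x * y) = (\<Sum>j<n. functional t (x * b j) * functional t (y * a j))"
    by (simp add: left_diff_distrib sum_distrib_right functional.diff functional.sum mult.assoc
        functional_mconst_mult mult.commute[of "a _" y])
qed (use a b in \<open>auto intro: polys_in_1 polys_in_mult\<close>)

lemma jacobian_annihilator_iff:
  fixes fs :: "nat \<Rightarrow> 'a::{alg_closed_field, field_char_0} mpoly"
  assumes fs: "\<forall>i\<in>{1..m}. fs i \<in> polys_in m" and res: "is_residue m (fs \<circ> Suc) t"
    and p: "p \<in> polys_in m"
  shows "p * jacobian m fs \<in> gen_ideal m fs \<longleftrightarrow> (\<exists>k. p ^ k \<in> gen_ideal m fs)"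
proof -
  let ?\<Delta> = "bez_delta m (fs \<circ> Suc)"
  have "?\<Delta> \<in> polys_in (2 * m)"
    by (rule polys_in_bez_delta) (simp add: fs)
  then obtain a b and n :: nat where a: "\<And>i. a i \<in> polys_in m" and b: "\<And>i. b i \<in> polys_in m"
    and \<Delta>: "?\<Delta> = (\<Sum>i<n. a i * to_y m (b i))"
    by (rule polys_in_double_eq_sum_mult_to_y) (rule that)
  interpret reproducing_form "functional t" "polys_in m" n a b
    by (rule reproducing_form_residue[OF fs res a b \<Delta>])
  have "jacobian m fs = diag m ?\<Delta>"
    by (simp add: diag_bez_delta_eq_jacobian fs)
  also have "\<dots> = casimir"
    by (simp add: \<Delta> casimir_def diag.hom_sum diag.hom_mult diag_eq_self diag_to_y a)
  finally have J: "jacobian m fs = casimir" .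
  have "p * casimir \<in> polys_in m"
    using p polys_in_jacobian[OF fs] by (simp add: polys_in_mult flip: J)
  then show ?thesis
    using casimir_annihilator_iff[OF p] p
    by (simp add: J in_gen_ideal_iff_functional_eq_0[OF fs res] polys_in_power)
qed

lemma yapply_bezoutian_eq_0_imp:
  fixes fs :: "nat \<Rightarrow> 'a::idom mpoly"
  assumes fs: "\<forall>i\<in>{1..m}. fs i \<in> polys_in m" and h: "h \<in> polys_in m"
    and "yapply m \<mu> (bezoutian m fs h) = 0"
  shows "yapply m \<mu> (bezoutian m fs 1) * h \<in> gen_ideal m fs"
proof -
  let ?P = "(fs \<circ> Suc) ` {..<m}" and ?\<Delta> = "bez_delta m (fs \<circ> Suc)"
  have "yapply m \<mu> (bezoutian m fs h - h * ?\<Delta>) \<in> ideal.span ?P"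
    by (rule yapply_in_ideal_span[where Q = "{}"]) (use fs bezoutian_cong_x[OF fs h] in auto)
  then have "h * yapply m \<mu> ?\<Delta> \<in> ideal.span ?P"
    using assms(3) ideal.span_neg by (fastforce simp: yapply.diff yapply_x_mult[OF h])
  then show ?thesis
    by (simp add: gen_ideal_eq[OF fs] bezoutian_1[OF fs] polys_in_mult polys_in_yapply h mult.commute)
qed

lemma yapply_bezoutian_eq_0_if:
  fixes fs :: "nat \<Rightarrow> 'a::idom mpoly"
  assumes fs: "\<forall>i\<in>{1..m}. fs i \<in> polys_in m" and res: "is_residue m (fs \<circ> Suc) t"
    and h: "h \<in> polys_in m" and p: "p \<in> polys_in m" and ph: "p * h \<in> gen_ideal m fs"
  shows "yapply m (\<lambda>\<beta>. functional t (p * mmonom \<beta>)) (bezoutian m fs h) = 0"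
proof -
  let ?P = "(fs \<circ> Suc) ` {..<m}" and ?\<Delta> = "bez_delta m (fs \<circ> Suc)"
  let ?Q = "insert (p * h) ?P"
  have "bezoutian m fs h - to_y m h * ?\<Delta> \<in> ideal.span (to_y m ` ?Q)"
    using bezoutian_cong_y[OF fs h] ideal.span_mono[of "to_y m ` ?P" "to_y m ` ?Q"] by blast
  then have "to_y m p * (bezoutian m fs h - to_y m h * ?\<Delta>) + ?\<Delta> * to_y m (p * h)
      \<in> ideal.span (to_y m ` ?Q)"
    by (intro ideal.span_add ideal.span_scale) (auto intro: ideal.span_base)
  then have "to_y m p * bezoutian m fs h \<in> ideal.span ({} \<union> to_y m ` ?Q)"
    by (simp add: to_y.hom_mult algebra_simps)
  moreover have "functional t (q * r) = 0" if "q \<in> ?Q" for q r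
    using that ph
    by (intro is_residue_mult_eq_0[OF res]) (auto simp: gen_ideal_eq[OF fs] intro: ideal.span_base)
  ultimately have "yapply m t (to_y m p * bezoutian m fs h) \<in> ideal.span {}"
    using fs p h by (intro yapply_in_ideal_span[where Q = ?Q]) (auto intro: polys_in_mult)
  then show ?thesis
    by (simp add: yapply_to_y_mult[OF p])
qed

lemma ideal_quotient_eq_bezoutian_kernel:
  fixes fs :: "nat \<Rightarrow> 'a::idom mpoly"
  assumes fs: "\<forall>i\<in>{1..m}. fs i \<in> polys_in m" and res: "is_residue m (fs \<circ> Suc) t"
    and h: "h \<in> polys_in m"
  shows "{p \<in> polys_in m. p * h \<in> gen_ideal m fs} =
    {yapply m \<mu> (bezoutian m fs 1) + q | \<mu> q. yapply m \<mu> (bezoutian m fs h) = 0 \<and> q \<in> gen_ideal m fs}"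
    (is "?quotient = ?kernel")
proof (intro equalityI subsetI)
  fix p assume "p \<in> ?quotient"
  then have p: "p \<in> polys_in m" and ph: "p * h \<in> gen_ideal m fs"
    by auto
  define \<mu> where "\<mu> = (\<lambda>\<beta>. functional t (p * mmonom \<beta>))"
  have "p - yapply m \<mu> (bezoutian m fs 1) \<in> gen_ideal m fs"
    using residue_reproducing[OF fs res p]
    by (simp only: \<mu>_def bezoutian_1[OF fs] yapply_to_y_mult[OF p])
  moreover have "yapply m \<mu> (bezoutian m fs h) = 0"
    unfolding \<mu>_def by (rule yapply_bezoutian_eq_0_if[OF fs res h p ph])
  moreover have "p = yapply m \<mu> (bezoutian m fs 1) + (p - yapply m \<mu> (bezoutian m fs 1))"
    by simp
  ultimately show "p \<in> ?kernel"
    by blast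
next
  fix p assume "p \<in> ?kernel"
  then obtain \<mu> q where p: "p = yapply m \<mu> (bezoutian m fs 1) + q"
    and \<mu>: "yapply m \<mu> (bezoutian m fs h) = 0" and q: "q \<in> gen_ideal m fs"
    by blast
  have "yapply m \<mu> (bezoutian m fs 1) * h + h * q \<in> gen_ideal m fs"
    using yapply_bezoutian_eq_0_imp[OF fs h \<mu>] q h
    by (simp add: gen_ideal_eq[OF fs] ideal.span_add ideal.span_scale polys_in_add polys_in_mult)
  then have "p * h \<in> gen_ideal m fs"
    by (simp add: p distrib_right mult.commute[of q])
  moreover have "p \<in> polys_in m"
    using q by (simp add: p gen_ideal_eq[OF fs] polys_in_add polys_in_yapply)
  ultimately show "p \<in> ?quotient"
    by simp
qed

theorem theorem4p3:
  fixes m :: nat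
    and fs :: "nat \<Rightarrow> 'a::{alg_closed_field, field_char_0} mpoly"
    and E E' :: "(nat \<Rightarrow>\<^sub>0 nat) set"
  assumes fs_in: "\<forall>i\<in>{1..m}. fs i \<in> polys_in m"
    and fin: "fin_dim_quotient m (gen_ideal m fs)"
    and E_fin: "finite E" and E'_fin: "finite E'"
    and E_vars: "\<forall>\<alpha>\<in>E. Poly_Mapping.keys \<alpha> \<subseteq> {..<m}"
    and E'_vars: "\<forall>\<beta>\<in>E'. Poly_Mapping.keys \<beta> \<subseteq> {..<m}"
    and supp: "\<forall>f0\<in>{1, jacobian m fs}. \<forall>\<alpha> \<beta>. Poly_Mapping.keys \<alpha> \<subseteq> {..<m} \<longrightarrow> Poly_Mapping.keys \<beta> \<subseteq> {..<m} \<longrightarrow>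
                 bez_coeff m fs f0 \<alpha> \<beta> \<noteq> 0 \<longrightarrow> \<alpha> \<in> E \<and> \<beta> \<in> E'"
  shows "radical_in m (gen_ideal m fs) =
     {(\<Sum>\<alpha>\<in>E. \<Sum>\<beta>\<in>E'. mconst (bez_coeff m fs 1 \<alpha> \<beta> * lam \<beta>) * mmonom \<alpha>) + q | lam q.
        (\<Sum>\<alpha>\<in>E. \<Sum>\<beta>\<in>E'. mconst (bez_coeff m fs (jacobian m fs) \<alpha> \<beta> * lam \<beta>) * mmonom \<alpha>) = 0
        \<and> q \<in> gen_ideal m fs}"
proof -
  have J: "jacobian m fs \<in> polys_in m"
    by (rule polys_in_jacobian[OF fs_in])
  have coeffs: "(\<Sum>\<alpha>\<in>E. \<Sum>\<beta>\<in>E'. mconst (bez_coeff m fs h \<alpha> \<beta> * lam \<beta>) * mmonom \<alpha>) =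
      yapply m lam (bezoutian m fs h)" if "h \<in> {1, jacobian m fs}" for h lam
    unfolding bez_coeff_def
  proof (rule yapply_eq_sum_coeffs[symmetric, OF _ E_fin E'_fin])
    show "bezoutian m fs h \<in> polys_in (2 * m)"
      using that J polys_in_1 by (intro polys_in_bezoutian fs_in) auto
  qed (use E_vars E'_vars supp that in \<open>unfold bez_coeff_def, blast+\<close>)
  obtain t where res: "is_residue m (fs \<circ> Suc) t"
    using residue_exists[of m "fs \<circ> Suc"] fin fs_in by (auto simp: gen_ideal_eq[OF fs_in])
  have "radical_in m (gen_ideal m fs) = {p \<in> polys_in m. p * jacobian m fs \<in> gen_ideal m fs}"
    using jacobian_annihilator_iff[OF fs_in res] by (auto simp: radical_in_def)
  then show ?thesis
    using ideal_quotient_eq_bezoutian_kernel[OF fs_in res J] by (simp add: coeffs)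
qed

end
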